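(* Assume (A1), (A2), (A3), (A4) and (A5). For $\varepsilon>0$ let $u^\varepsilon$ be the viscosity solution of $$\partial_t^\alpha u^\varepsilon + H\left(\tfrac{x}{\varepsilon}, Du^\varepsilon\right)=0 \ \text{ in } \mathbb{R}^N\times(0,T),\qquad u^\varepsilon(\cdot,0)=u_0 \ \text{ on } \mathbb{R}^N,$$ and let $\overline u$ be the viscosity solution of $$\partial_t^\alpha \overline{u} + \overline{H}(D\overline{u})=0 \ \text{ in } \mathbb{R}^N\times(0,T),\qquad \overline{u}(\cdot,0)=u_0 \ \text{ on } \mathbb{R}^N,$$ where $\overline{H}$ is the effective Hamiltonian of $H$. Then for each $\nu\in(0,1)$ there exists a constant $C>0$, independent of $\varepsilon$, such that $$\sup_{(x,t)\in\mathbb{R}^N\times(0,T)}|u^\varepsilon(x,t)-\overline u(x,t)|\le C\,\varepsilon^{\frac{1}{3(2-\nu)}} .$$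
   Context: $T>0$ and $\alpha\in(0,1)$ are fixed constants, and $\varepsilon>0$ is a parameter. $H:\mathbb{R}^N\times\mathbb{R}^N\to\mathbb{R}$, $(y,p)\mapsto H(y,p)$, and $u_0:\mathbb{R}^N\to\mathbb{R}$ are continuous. The assumptions are: (A1) $\lim_{r\to\infty}\inf\{H(y,p): y\in\mathbb{R}^N, |p|\ge r\}=\infty$. (A2) $H(y+k,p)=H(y,p)$ for all $y,p\in\mathbb{R}^N$, $k\in\mathbb{Z}^N$. (A3) $u_0\in \mathrm{Lip}(\mathbb{R}^N)\cap \mathrm{BUC}(\mathbb{R}^N)$ ($u_0$ is Lipschitz, bounded and uniformly continuous). (A4) There exists $C>0$ such that $|H(x,p)-H(y,q)|\le C(|x-y|+|p-q|)$ for all $x,y,p,q\in\mathbb{R}^N$. (A5) There exists $C>0$ such that $H(x,p)\ge C^{-1}|p|-C$ for all $x,p\in\mathbb{R}^N$. Caputo derivative: $\partial_t^\alpha u(x,t)=\frac{1}{\Gamma(1-\alpha)}\int_0^t (t-s)^{-\alpha}\partial_s u(x,s)\,ds$. For a function $f$ of $(x,t)$, $t\in(0,T]$ and $0\le a<b\le t$ put $$J[f](x,t)=\frac{f(x,t)-f(x,0)}{t^\alpha\,\Gamma(1-\alpha)},\qquad K_{(a,b)}[f](x,t)=\frac{\alpha}{\Gamma(1-\alpha)}\int_a^b\frac{f(x,t)-f(x,t-\tau)}{\tau^{\alpha+1}}\,d\tau .$$ Viscosity solutions: for a continuous $F:\mathbb{R}^N\times\mathbb{R}^N\to\mathbb{R}$,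 an upper semicontinuous $u:\mathbb{R}^N\times[0,T]\to\mathbb{R}$ is a viscosity subsolution of $\partial_t^\alpha u+F(x,Du)=0$, $u(\cdot,0)=u_0$, if $u(\cdot,0)\le u_0$ and, for every $\varphi\in C^1(\mathbb{R}^N\times(0,T])\cap C(\mathbb{R}^N\times[0,T])$, whenever $u-\varphi$ attains a maximum over $\mathbb{R}^N\times[0,T]$ at $(\hat x,\hat t)\in\mathbb{R}^N\times(0,T]$, $$J[\varphi](\hat x,\hat t)+K_{(0,\hat t)}[\varphi](\hat x,\hat t)+F(\hat x,D\varphi(\hat x,\hat t))\le 0 .$$ A lower semicontinuous $u$ is a viscosity supersolution if $u(\cdot,0)\ge u_0$ and the reverse inequality ($\ge 0$) holds whenever $u-\varphi$ attains a minimum over $\mathbb{R}^N\times[0,T]$ at $(\hat x,\hat t)\in\mathbb{R}^N\times(0,T]$. A continuous function is a viscosity solution if it is both. Here $D$ is the gradient in $x$. The problem for $u^\varepsilon$ corresponds to $F(x,p)=H(x/\varepsilon,p)$, and the problem for $\overline u$ to $F(x,p)=\overline H(p)$. "The viscosity solution" means the unique viscosity solution in $\mathrm{BUC}(\mathbb{R}^N\times[0,T])$. Effective Hamiltonian: for each $p\in\mathbb{R}^N$, $\overline H(p)\in\mathbb{R}$ is the unique constant for which the cell problem $H(y,p+Dv(y))=\overline H(p)$ in $\mathbb{T}^N=\mathbb{R}^N/\mathbb{Z}^N$ has a continuous viscosity solution $v$. *)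

theory Defs
  imports "HOL-Analysis.Analysis"
begin

text \<open>
  Functions on \<open>\<real>\<^sup>N \<times> [0,T]\<close> are total functions on
  \<open>(real^'n) \<times> real\<close>; only their values on the set \<open>space_time T\<close> are ever used.
\<close>

definition space_time :: "real \<Rightarrow> ('a \<times> real) set"
  where "space_time T = UNIV \<times> {0..T}"

definition usc_on :: "'a::topological_space set \<Rightarrow> ('a \<Rightarrow> real) \<Rightarrow> bool"
  where "usc_on S f \<longleftrightarrow> (\<forall>c. openin (top_of_set S) {z\<in>S. f z < c})"

definition lsc_on :: "'a::topological_space set \<Rightarrow> ('a \<Rightarrow> real) \<Rightarrow> bool"
  where "lsc_on S f \<longleftrightarrow> (\<forall>c. openin (top_of_set S) {z\<in>S. c < f z})"

definition BUC_on :: "'a::metric_space set \<Rightarrow> ('a \<Rightarrow> real) \<Rightarrow> bool"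
  where "BUC_on S f \<longleftrightarrow> bounded (f ` S) \<and> uniformly_continuous_on S f"

text \<open>
  The derivative is taken within \<open>S\<close>, so on \<open>\<real>\<^sup>N \<times> (0,T]\<close> the time derivative
  at \<open>t = T\<close> is one-sided.
\<close>

definition C1_on :: "'a::real_inner set \<Rightarrow> ('a \<Rightarrow> real) \<Rightarrow> bool"
  where "C1_on S f \<longleftrightarrow>
    (\<exists>g. continuous_on S g \<and> (\<forall>z\<in>S. (f has_derivative (\<lambda>h. h \<bullet> g z)) (at z within S)))"

definition grad :: "('a::real_inner \<Rightarrow> real) \<Rightarrow> 'a \<Rightarrow> 'a"
  where "grad f x = (THE q. GDERIV f x :> q)"

definition caputo_J :: "real \<Rightarrow> ('a \<times> real \<Rightarrow> real) \<Rightarrow> 'a \<Rightarrow> real \<Rightarrow> real"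
  where "caputo_J \<alpha> f x t = (f (x, t) - f (x, 0)) / (t powr \<alpha> * Gamma (1 - \<alpha>))"

definition caputo_K :: "real \<Rightarrow> real \<Rightarrow> real \<Rightarrow> ('a \<times> real \<Rightarrow> real) \<Rightarrow> 'a \<Rightarrow> real \<Rightarrow> real"
  where "caputo_K \<alpha> a b f x t =
    \<alpha> / Gamma (1 - \<alpha>) *
      (LBINT \<tau>:{a<..<b}. (f (x, t) - f (x, t - \<tau>)) / \<tau> powr (\<alpha> + 1))"

definition test_function :: "real \<Rightarrow> ('a::real_inner \<times> real \<Rightarrow> real) \<Rightarrow> bool"
  where "test_function T \<phi> \<longleftrightarrow>
    C1_on (UNIV \<times> {0<..T}) \<phi> \<and> continuous_on (space_time T) \<phi>"

text \<open>
  Sub-, super- and solutions of \<open>\<partial>\<^sub>t\<^sup>\<alpha> u + F(x, Du) = 0\<close> with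
  \<open>u(\<cdot>,0) = u\<^sub>0\<close>.
\<close>

definition caputo_subsolution ::
    "real \<Rightarrow> real \<Rightarrow> ('a::real_inner \<Rightarrow> 'a \<Rightarrow> real) \<Rightarrow> ('a \<Rightarrow> real) \<Rightarrow> ('a \<times> real \<Rightarrow> real) \<Rightarrow> bool"
  where "caputo_subsolution \<alpha> T F u0 u \<longleftrightarrow>
    usc_on (space_time T) u \<and>
    (\<forall>x. u (x, 0) \<le> u0 x) \<and>
    (\<forall>\<phi> x t. test_function T \<phi> \<longrightarrow> t \<in> {0<..T} \<longrightarrow>
       (\<forall>z\<in>space_time T. u z - \<phi> z \<le> u (x, t) - \<phi> (x, t)) \<longrightarrow>
       caputo_J \<alpha> \<phi> x t + caputo_K \<alpha> 0 t \<phi> x t + F x (grad (\<lambda>y. \<phi> (y, t)) x) \<le> 0)"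

definition caputo_supersolution ::
    "real \<Rightarrow> real \<Rightarrow> ('a::real_inner \<Rightarrow> 'a \<Rightarrow> real) \<Rightarrow> ('a \<Rightarrow> real) \<Rightarrow> ('a \<times> real \<Rightarrow> real) \<Rightarrow> bool"
  where "caputo_supersolution \<alpha> T F u0 u \<longleftrightarrow>
    lsc_on (space_time T) u \<and>
    (\<forall>x. u (x, 0) \<ge> u0 x) \<and>
    (\<forall>\<phi> x t. test_function T \<phi> \<longrightarrow> t \<in> {0<..T} \<longrightarrow>
       (\<forall>z\<in>space_time T. u z - \<phi> z \<ge> u (x, t) - \<phi> (x, t)) \<longrightarrow>
       caputo_J \<alpha> \<phi> x t + caputo_K \<alpha> 0 t \<phi> x t + F x (grad (\<lambda>y. \<phi> (y, t)) x) \<ge> 0)"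

definition caputo_viscosity_solution ::
    "real \<Rightarrow> real \<Rightarrow> ('a::real_inner \<Rightarrow> 'a \<Rightarrow> real) \<Rightarrow> ('a \<Rightarrow> real) \<Rightarrow> ('a \<times> real \<Rightarrow> real) \<Rightarrow> bool"
  where "caputo_viscosity_solution \<alpha> T F u0 u \<longleftrightarrow>
    continuous_on (space_time T) u \<and>
    caputo_subsolution \<alpha> T F u0 u \<and> caputo_supersolution \<alpha> T F u0 u"

definition integer_periodic :: "(real^'n \<Rightarrow> 'b) \<Rightarrow> bool"
  where "integer_periodic f \<longleftrightarrow> (\<forall>y k. (\<forall>i. k $ i \<in> \<int>) \<longrightarrow> f (y + k) = f y)"

text \<open>
  A function on the torus is represented by its periodic lift to \<open>\<real>\<^sup>N\<close>. Test functions are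
  arbitrary \<open>C\<^sup>1\<close> functions on \<open>\<real>\<^sup>N\<close>, touching the lift globally; since a periodic
  continuous \<open>v\<close> is bounded and only first derivatives enter, this agrees with testing at local
  extrema and with testing by periodic functions.
\<close>

definition cell_solution ::
    "(real^'n \<Rightarrow> real^'n \<Rightarrow> real) \<Rightarrow> real^'n \<Rightarrow> real \<Rightarrow> (real^'n \<Rightarrow> real) \<Rightarrow> bool"
  where "cell_solution H p c v \<longleftrightarrow>
    continuous_on UNIV v \<and> integer_periodic v \<and>
    (\<forall>\<psi> y. C1_on UNIV \<psi> \<longrightarrow> (\<forall>z. v z - \<psi> z \<le> v y - \<psi> y) \<longrightarrow> H y (p + grad \<psi> y) \<le> c) \<and>
    (\<forall>\<psi> y. C1_on UNIV \<psi> \<longrightarrow> (\<forall>z. v z - \<psi> z \<ge> v y - \<psi> y) \<longrightarrow> H y (p + grad \<psi> y) \<ge> c)"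

definition effective_hamiltonian ::
    "(real^'n \<Rightarrow> real^'n \<Rightarrow> real) \<Rightarrow> (real^'n \<Rightarrow> real) \<Rightarrow> bool"
  where "effective_hamiltonian H Hbar \<longleftrightarrow>
    (\<forall>p. (\<exists>v. cell_solution H p (Hbar p) v) \<and>
         (\<forall>c. (\<exists>v. cell_solution H p c v) \<longrightarrow> c = Hbar p))"

end

theory Submission
  imports Defs
begin

text \<open>
  The estimate is proved with the exponent 1/3, the classical one for first order
  Hamilton-Jacobi equations, in the form \<open>\<bar>u \<epsilon> z - ubar z\<bar> \<le> R * \<epsilon> powr (1 / 3)\<close> for \<open>\<epsilon> \<le> 1\<close>.
  Since \<open>1 / (3 * (2 - \<nu>)) \<le> 1 / 3\<close>, this implies the claim for such \<open>\<epsilon>\<close>, and for \<open>\<epsilon> > 1\<close> a bound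
  on \<open>u \<epsilon>\<close> that is uniform in \<open>\<epsilon>\<close> is enough (\<open>subsolution_upper_bound\<close>).

  Heuristically \<open>u \<epsilon> (x, t)\<close> is \<open>ubar (x, t) + \<epsilon> * v (x / \<epsilon>)\<close>, where \<open>v\<close> solves the cell problem
  for the slope \<open>p = D ubar (x, t)\<close>. To make this rigorous without smoothness of \<open>ubar\<close>, one doubles
  the variables with the penalty \<open>(norm (x - y))\<^sup>2 / (2 * \<eta>)\<close>. At an approximate maximum point of
  the doubled functional the slope \<open>p0 = (x0 - y0) / \<eta>\<close> is frozen, the corrector for this one
  slope is subtracted, and a localising penalty keeps the new maximum within a distance of order
  \<open>sqrt (\<epsilon> * \<eta>)\<close> of the old one, so that slopes change by \<open>sqrt (\<epsilon> / \<eta>)\<close> only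
  (\<open>perturbed_doubling\<close>). Together with the usual error of order \<open>\<eta>\<close> from the penalty this gives
  \<open>\<epsilon> powr (1 / 3)\<close> for \<open>\<eta> = \<epsilon> powr (1 / 3)\<close> (\<open>one_sided_rate\<close>).

  The argument needs \<open>p0\<close> to be bounded. This follows from a spatial Lipschitz bound for \<open>ubar\<close>
  alone, which is available because the effective equation is invariant under translations
  (\<open>comparison_homogeneous\<close>, \<open>subsolution_translate\<close>). For bounded \<open>p0\<close> the correctors have a
  uniformly bounded oscillation by coercivity (\<open>cell_solution_osc\<close>), and the effective Hamiltonian
  is Lipschitz by comparison in the cell problem (\<open>cell_constant_lipschitz\<close>).

  The memory of the Caputo derivative enters in two places. First, the time variable has to be
  doubled, while the definition of viscosity solutions puts the test function into the entire
  history. Test functions that follow the solution closely away from the contact time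
  (\<open>subsolution_touch\<close>) and a penalty that is invariant under common time shifts make the history
  terms cancel (\<open>caputo_doubling\<close>). Second, the boundary term of the Caputo derivative at time 0 is
  strictly positive when \<open>u \<epsilon> - ubar\<close> has grown since time 0, and it bounds this growth by
  \<open>T powr \<alpha> * Gamma (1 - \<alpha>)\<close> times the error in the equation.
\<close>

section \<open>The Caputo derivative of a function of time\<close>

text \<open>
  Integration by parts turns the Caputo derivative of a \<open>C\<^sup>1\<close> function into this form, which
  makes sense for Lipschitz functions and obeys a maximum principle: the value at the present
  time \<open>t\<close> enters with a positive sign, all values in the past with a negative one.
\<close>

definition caputo :: "real \<Rightarrow> (real \<Rightarrow> real) \<Rightarrow> real \<Rightarrow> real"
  where "caputo \<alpha> g t = (g t - g 0) / (t powr \<alpha> * Gamma (1 - \<alpha>)) +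
    \<alpha> / Gamma (1 - \<alpha>) * (LBINT \<tau>:{0<..<t}. (g t - g (t - \<tau>)) / \<tau> powr (\<alpha> + 1))"

lemma caputo_J_plus_K:
  "caputo_J \<alpha> f x t + caputo_K \<alpha> 0 t f x t = caputo \<alpha> (\<lambda>s. f (x, s)) t"
  by (simp add: caputo_J_def caputo_K_def caputo_def)

lemma powr_integral:
  fixes b t :: real
  assumes b: "0 < b" "b < 1" and t: "0 \<le> t"
  shows "set_integrable lborel {0<..<t} (\<lambda>\<tau>. \<tau> powr (- b))"
    and "(LBINT \<tau>:{0<..<t}. \<tau> powr (- b)) = t powr (1 - b) / (1 - b)"
proof -
  have hi: "((\<lambda>\<tau>. \<tau> powr (- b)) has_integral (t powr (1 - b) / (1 - b))) {0..t}"
    using has_integral_powr_from_0[of "-b" t] b t by (simp add: add.commute)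
  have hi': "((\<lambda>\<tau>. \<tau> powr (- b)) has_integral (t powr (1 - b) / (1 - b))) {0<..<t}"
    using hi by (simp add: has_integral_Icc_iff_Ioo)
  have "(\<lambda>\<tau>. \<tau> powr (- b)) absolutely_integrable_on {0<..<t}"
    by (rule nonnegative_absolutely_integrable_1) (use hi' in \<open>auto simp: integrable_on_def\<close>)
  moreover have "(\<lambda>x. indicat_real {0<..<t} x *\<^sub>R x powr (- b)) \<in> borel_measurable lborel"
    by measurable
  ultimately show si: "set_integrable lborel {0<..<t} (\<lambda>\<tau>. \<tau> powr (- b))"
    unfolding set_integrable_def by (simp add: integrable_completion)
  show "(LBINT \<tau>:{0<..<t}. \<tau> powr (- b)) = t powr (1 - b) / (1 - b)"
    using set_borel_integral_eq_integral(2)[OF si] hi' by (simp add: integral_unique)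
qed

lemma caputo_kernel_integrable:
  fixes t :: real
  assumes \<alpha>: "0 < \<alpha>" "\<alpha> < 1" and g: "L-lipschitz_on {0..T} g" and t: "0 < t" "t \<le> T"
  shows "set_integrable lborel {0<..<t} (\<lambda>\<tau>. (g t - g (t - \<tau>)) / \<tau> powr (\<alpha> + 1))"
proof -
  have c: "continuous_on {0<..<t} (\<lambda>\<tau>. (g t - g (t - \<tau>)) / \<tau> powr (\<alpha> + 1))"
  proof -
    have "continuous_on {0<..<t} (\<lambda>\<tau>. g (t - \<tau>))"
    proof (rule continuous_on_compose2[OF lipschitz_on_continuous_on[OF g]])
      show "(\<lambda>\<tau>. t - \<tau>) ` {0<..<t} \<subseteq> {0..T}"
        by (rule image_subsetI) (use t in simp)
    qed (intro continuous_intros)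
    then show ?thesis by (intro continuous_intros) auto
  qed
  show ?thesis
  proof (rule set_integrable_bound)
    show "set_integrable lborel {0<..<t} (\<lambda>\<tau>. L * \<tau> powr (- \<alpha>))"
      using powr_integral(1)[of \<alpha> t] \<alpha> t by (intro set_integrable_mult_right) auto
    show "set_borel_measurable lborel {0<..<t} (\<lambda>\<tau>. (g t - g (t - \<tau>)) / \<tau> powr (\<alpha> + 1))"
      unfolding set_borel_measurable_def
      using borel_measurable_continuous_on_indicator[OF _ c] by simp
    have "norm ((g t - g (t - \<tau>)) / \<tau> powr (\<alpha> + 1)) \<le> norm (L * \<tau> powr (- \<alpha>))"
      if \<tau>: "\<tau> \<in> {0<..<t}" for \<tau>
    proof -
      have "\<bar>g t - g (t - \<tau>)\<bar> \<le> L * \<tau>"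
        using lipschitz_onD[OF g, of t "t - \<tau>"] t \<tau> by (auto simp: dist_real_def)
      then have "\<bar>g t - g (t - \<tau>)\<bar> / \<tau> powr (\<alpha> + 1) \<le> L * \<tau> / \<tau> powr (\<alpha> + 1)"
        by (rule divide_right_mono) simp
      also have "\<dots> = L * \<tau> powr (- \<alpha>)"
        using \<tau> by (simp add: powr_add powr_minus field_simps)
      finally show ?thesis using \<tau> lipschitz_on_nonneg[OF g] by (simp add: abs_mult)
    qed
    then show "AE x in lborel. x \<in> {0<..<t} \<longrightarrow>
        norm ((g t - g (t - x)) / x powr (\<alpha> + 1)) \<le> norm (L * x powr (- \<alpha>))" by auto
  qed
qed

text \<open>
  Mean value theorem. It controls the error that arises when the weights \<open>t powr - \<alpha>\<close> and
  \<open>s powr - \<alpha>\<close> of two nearby times are exchanged in the boundary terms of two Caputo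
  derivatives.
\<close>

lemma powr_neg_diff_le:
  fixes a m t s :: real
  assumes "0 < a" "0 < m" "m \<le> t" "t \<le> s"
  shows "t powr (-a) - s powr (-a) \<le> a * m powr (-a - 1) * (s - t)"
proof (cases "t = s")
  case False
  then have ts: "t < s" using assms by simp
  have d: "((\<lambda>x. x powr (-a)) has_real_derivative (-a * x powr (-a-1))) (at x)"
    if "t \<le> x" "x \<le> s" for x
    using that assms by (auto intro!: derivative_eq_intros)
  obtain z where z: "t < z" "z < s" "s powr (-a) - t powr (-a) = (s - t) * (-a * z powr (-a-1))"
    using MVT2[OF ts d] by blast
  have "z powr (-a-1) \<le> m powr (-a-1)"
    using z assms by (intro powr_mono2') auto
  then have "(s-t) * (a * z powr (-a-1)) \<le> (s-t) * (a * m powr (-a-1))"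
    using ts assms by (intro mult_left_mono) auto
  with z(3) show ?thesis by (simp add: mult_ac)
qed (use assms in auto)

text \<open>
  Two Caputo derivatives at nearby times \<open>t \<le> s\<close> can be added under one integral sign for
  delays \<open>\<tau> < t\<close>, where the joint increments are nonnegative up to \<open>k * \<tau>\<close>; the error is
  integrable because \<open>\<tau> powr - \<alpha>\<close> is. The delays in \<open>[t, s)\<close> contribute at most
  \<open>B * (s - t)\<close> times the kernel at \<open>m\<close>. What remains is the boundary term, which turns the
  total increase \<open>N\<close> since time 0 into the positive contribution \<open>N * T powr - \<alpha>\<close>. This
  contribution does the work that a strictly increasing penalty in \<open>t\<close> does for equations of
  first order in time.
\<close>

lemma caputo_sum_lower_ordered:
  assumes \<alpha>: "0 < \<alpha>" "\<alpha> < 1"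
    and g: "Lg-lipschitz_on {0..T} g" and h: "Lh-lipschitz_on {0..T} h"
    and ord: "0 < m" "m \<le> t" "t \<le> s" "s \<le> T"
    and incr: "\<And>\<tau>. 0 < \<tau> \<Longrightarrow> \<tau> < t \<Longrightarrow> (g t - g (t - \<tau>)) + (h s - h (s - \<tau>)) \<ge> - k * \<tau>"
    and gB: "\<And>\<tau>. m \<le> \<tau> \<Longrightarrow> \<tau> \<le> t \<Longrightarrow> g t - g (t - \<tau>) \<ge> - B"
    and hB: "\<And>\<tau>. m \<le> \<tau> \<Longrightarrow> \<tau> \<le> s \<Longrightarrow> h s - h (s - \<tau>) \<ge> - B"
    and B: "0 \<le> B"
    and J: "(g t - g 0) + (h s - h 0) \<ge> N - e" and N: "0 \<le> N" and e: "0 \<le> e"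
  shows "caputo \<alpha> g t + caputo \<alpha> h s \<ge>
    (N * T powr (-\<alpha>) - e * m powr (-\<alpha>) - 2 * \<alpha> * B * m powr (-\<alpha>-1) * (s - t)
      - \<alpha> * k * (t powr (1 - \<alpha>) / (1 - \<alpha>))) / Gamma (1 - \<alpha>)"
proof -
  have G: "Gamma (1 - \<alpha>) > 0" using \<alpha> by (intro Gamma_real_pos) auto
  define Kg where "Kg = (\<lambda>\<tau>. (g t - g (t - \<tau>)) / \<tau> powr (\<alpha> + 1))"
  define Kh where "Kh = (\<lambda>\<tau>. (h s - h (s - \<tau>)) / \<tau> powr (\<alpha> + 1))"
  have ig: "set_integrable lborel {0<..<t} Kg" unfolding Kg_def
    using caputo_kernel_integrable[OF \<alpha> g] ord by simp
  have ih: "set_integrable lborel {0<..<s} Kh" unfolding Kh_def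
    using caputo_kernel_integrable[OF \<alpha> h] ord by simp
  have ih1: "set_integrable lborel {0<..<t} Kh"
    by (rule set_integrable_subset[OF ih]) (use ord in auto)
  have ih2: "set_integrable lborel {t..<s} Kh"
    by (rule set_integrable_subset[OF ih]) (use ord in auto)
  have split: "(LBINT \<tau>:{0<..<s}. Kh \<tau>) = (LBINT \<tau>:{0<..<t}. Kh \<tau>) + (LBINT \<tau>:{t..<s}. Kh \<tau>)"
  proof -
    have "{0<..<s} = {0<..<t} \<union> {t..<s}" "{0<..<t} \<inter> {t..<s} = {}" using ord by auto
    then show ?thesis using set_integral_Un[OF _ ih1 ih2] by simp
  qed
  have tail: "(LBINT \<tau>:{t..<s}. Kh \<tau>) \<ge> - B * m powr (-\<alpha>-1) * (s - t)"
  proof -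
    have "(LBINT \<tau>:{t..<s}. - B * m powr (-\<alpha>-1)) \<le> (LBINT \<tau>:{t..<s}. Kh \<tau>)"
    proof (rule set_integral_mono)
      show "set_integrable lborel {t..<s} (\<lambda>\<tau>. - B * m powr (-\<alpha>-1))"
        using integrable_real_indicator[of "{t..<s}" lborel] ord by (simp add: set_integrable_def)
      fix \<tau> assume \<tau>: "\<tau> \<in> {t..<s}"
      then have \<tau>': "m \<le> \<tau>" "\<tau> \<le> s" "0 < \<tau>" using ord by auto
      have "- Kh \<tau> = - (h s - h (s - \<tau>)) * \<tau> powr (-\<alpha>-1)"
        using \<tau>' by (simp add: Kh_def powr_add powr_minus powr_diff field_simps)
      also have "\<dots> \<le> B * \<tau> powr (-\<alpha>-1)"
        using hB[OF \<tau>'(1,2)] by (intro mult_right_mono) auto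
      also have "\<dots> \<le> B * m powr (-\<alpha>-1)"
        using \<tau>' \<alpha> ord B by (intro mult_left_mono powr_mono2') auto
      finally show "- B * m powr (-\<alpha>-1) \<le> Kh \<tau>" by simp
    qed (rule ih2)
    moreover have "(LBINT \<tau>:{t..<s}. - B * m powr (-\<alpha>-1)) = - B * m powr (-\<alpha>-1) * (s - t)"
      using ord by (simp add: set_lebesgue_integral_def)
    ultimately show ?thesis by simp
  qed
  have head: "(LBINT \<tau>:{0<..<t}. Kg \<tau>) + (LBINT \<tau>:{0<..<t}. Kh \<tau>) \<ge> - k * (t powr (1-\<alpha>) / (1-\<alpha>))"
  proof -
    have "(LBINT \<tau>:{0<..<t}. - k * \<tau> powr (-\<alpha>)) \<le> (LBINT \<tau>:{0<..<t}. Kg \<tau> + Kh \<tau>)"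
    proof (rule set_integral_mono)
      show "set_integrable lborel {0<..<t} (\<lambda>\<tau>. - k * \<tau> powr (-\<alpha>))"
        using powr_integral(1)[of \<alpha> t] \<alpha> ord by (intro set_integrable_mult_right) auto
      show "set_integrable lborel {0<..<t} (\<lambda>\<tau>. Kg \<tau> + Kh \<tau>)"
        using ig ih1 by (rule set_integral_add)
      fix \<tau> assume \<tau>: "\<tau> \<in> {0<..<t}"
      have "- k * \<tau> powr (-\<alpha>) = (- k * \<tau>) / \<tau> powr (\<alpha> + 1)"
        using \<tau> by (simp add: powr_add powr_minus field_simps)
      also have "\<dots> \<le> ((g t - g (t - \<tau>)) + (h s - h (s - \<tau>))) / \<tau> powr (\<alpha> + 1)"
        using incr[of \<tau>] \<tau> by (intro divide_right_mono) auto
      also have "\<dots> = Kg \<tau> + Kh \<tau>" by (simp add: Kg_def Kh_def add_divide_distrib)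
      finally show "- k * \<tau> powr (-\<alpha>) \<le> Kg \<tau> + Kh \<tau>" .
    qed
    then show ?thesis
      using powr_integral(2)[of \<alpha> t] \<alpha> ord set_integral_add(2)[OF ig ih1]
        set_integral_mult_right[of lborel "{0<..<t}" "- k" "\<lambda>\<tau>. \<tau> powr (-\<alpha>)"] by simp
  qed
  have Jest: "(g t - g 0) * t powr (-\<alpha>) + (h s - h 0) * s powr (-\<alpha>) \<ge>
     N * T powr (-\<alpha>) - e * m powr (-\<alpha>) - \<alpha> * B * m powr (-\<alpha>-1) * (s - t)"
  proof -
    have a: "t powr (-\<alpha>) - s powr (-\<alpha>) \<le> \<alpha> * m powr (-\<alpha>-1) * (s - t)"
      using powr_neg_diff_le[of \<alpha> m t s] \<alpha> ord by simp
    have a0: "t powr (-\<alpha>) - s powr (-\<alpha>) \<ge> 0"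
      using \<alpha> ord by (simp add: powr_mono2')
    have g0: "g t - g 0 \<ge> - B" using gB[of t] ord by simp
    have "(g t - g 0) * (t powr (-\<alpha>) - s powr (-\<alpha>)) \<ge> (-B) * (t powr (-\<alpha>) - s powr (-\<alpha>))"
      using g0 a0 by (rule mult_right_mono)
    moreover have "B * (t powr (-\<alpha>) - s powr (-\<alpha>)) \<le> B * (\<alpha> * m powr (-\<alpha>-1) * (s - t))"
      using a B by (rule mult_left_mono)
    moreover have "((g t - g 0) + (h s - h 0)) * s powr (-\<alpha>) \<ge> (N - e) * s powr (-\<alpha>)"
      using J by (rule mult_right_mono) simp
    moreover have "N * s powr (-\<alpha>) \<ge> N * T powr (-\<alpha>)"
      using N \<alpha> ord by (intro mult_left_mono powr_mono2') auto
    moreover have "e * s powr (-\<alpha>) \<le> e * m powr (-\<alpha>)"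
      using e \<alpha> ord by (intro mult_left_mono powr_mono2') auto
    ultimately show ?thesis by (simp add: algebra_simps)
  qed
  have "caputo \<alpha> g t + caputo \<alpha> h s =
    (((g t - g 0) * t powr (-\<alpha>) + (h s - h 0) * s powr (-\<alpha>)) +
     \<alpha> * ((LBINT \<tau>:{0<..<t}. Kg \<tau>) + (LBINT \<tau>:{0<..<s}. Kh \<tau>))) / Gamma (1-\<alpha>)"
    unfolding caputo_def Kg_def Kh_def using G ord by (simp add: powr_minus field_simps)
  also have "\<dots> \<ge> (N * T powr (-\<alpha>) - e * m powr (-\<alpha>) - 2 * \<alpha> * B * m powr (-\<alpha>-1) * (s - t)
      - \<alpha> * k * (t powr (1 - \<alpha>) / (1 - \<alpha>))) / Gamma (1 - \<alpha>)"
  proof (rule divide_right_mono)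
    have "(LBINT \<tau>:{0<..<t}. Kg \<tau>) + (LBINT \<tau>:{0<..<s}. Kh \<tau>) \<ge>
       - k * (t powr (1-\<alpha>) / (1-\<alpha>)) - B * m powr (-\<alpha>-1) * (s - t)"
      using head tail split by simp
    then have "\<alpha> * ((LBINT \<tau>:{0<..<t}. Kg \<tau>) + (LBINT \<tau>:{0<..<s}. Kh \<tau>)) \<ge>
       \<alpha> * (- k * (t powr (1-\<alpha>) / (1-\<alpha>)) - B * m powr (-\<alpha>-1) * (s - t))"
      using \<alpha> by (intro mult_left_mono) auto
    then show "N * T powr (-\<alpha>) - e * m powr (-\<alpha>) - 2 * \<alpha> * B * m powr (-\<alpha>-1) * (s - t)
      - \<alpha> * k * (t powr (1 - \<alpha>) / (1 - \<alpha>)) \<le>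
      ((g t - g 0) * t powr (-\<alpha>) + (h s - h 0) * s powr (-\<alpha>)) +
     \<alpha> * ((LBINT \<tau>:{0<..<t}. Kg \<tau>) + (LBINT \<tau>:{0<..<s}. Kh \<tau>))"
      using Jest by (simp add: algebra_simps)
  qed (use G in auto)
  finally show ?thesis by simp
qed

lemma caputo_sum_lower:
  assumes \<alpha>: "0 < \<alpha>" "\<alpha> < 1"
    and g: "Lg-lipschitz_on {0..T} g" and h: "Lh-lipschitz_on {0..T} h"
    and ord: "0 < m" "m \<le> t" "t \<le> T" "m \<le> s" "s \<le> T"
    and incr: "\<And>\<tau>. 0 < \<tau> \<Longrightarrow> \<tau> < t \<Longrightarrow> \<tau> < s \<Longrightarrow>
      (g t - g (t - \<tau>)) + (h s - h (s - \<tau>)) \<ge> - k * \<tau>"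
    and gB: "\<And>\<tau>. m \<le> \<tau> \<Longrightarrow> \<tau> \<le> t \<Longrightarrow> g t - g (t - \<tau>) \<ge> - B"
    and hB: "\<And>\<tau>. m \<le> \<tau> \<Longrightarrow> \<tau> \<le> s \<Longrightarrow> h s - h (s - \<tau>) \<ge> - B"
    and B: "0 \<le> B" and k: "0 \<le> k"
    and J: "(g t - g 0) + (h s - h 0) \<ge> N - e" and N: "0 \<le> N" and e: "0 \<le> e"
  shows "caputo \<alpha> g t + caputo \<alpha> h s \<ge>
    (N * T powr (-\<alpha>) - e * m powr (-\<alpha>) - 2 * \<alpha> * B * m powr (-\<alpha>-1) * \<bar>t - s\<bar>
      - \<alpha> * k * (T powr (1 - \<alpha>) / (1 - \<alpha>))) / Gamma (1 - \<alpha>)"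
proof -
  have G: "Gamma (1 - \<alpha>) > 0" using \<alpha> by (intro Gamma_real_pos) auto
  have mono: "\<alpha> * k * (r powr (1 - \<alpha>) / (1 - \<alpha>)) \<le> \<alpha> * k * (T powr (1 - \<alpha>) / (1 - \<alpha>))"
    if "0 \<le> r" "r \<le> T" for r
    using that \<alpha> k by (intro mult_left_mono divide_right_mono powr_mono2) auto
  show ?thesis
  proof (cases "t \<le> s")
    case True
    have "(N * T powr (-\<alpha>) - e * m powr (-\<alpha>) - 2 * \<alpha> * B * m powr (-\<alpha>-1) * \<bar>t - s\<bar>
        - \<alpha> * k * (T powr (1 - \<alpha>) / (1 - \<alpha>))) / Gamma (1 - \<alpha>) \<le>
       (N * T powr (-\<alpha>) - e * m powr (-\<alpha>) - 2 * \<alpha> * B * m powr (-\<alpha>-1) * (s - t)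
        - \<alpha> * k * (t powr (1 - \<alpha>) / (1 - \<alpha>))) / Gamma (1 - \<alpha>)"
      using True mono[of t] ord G by (intro divide_right_mono) auto
    also have "\<dots> \<le> caputo \<alpha> g t + caputo \<alpha> h s"
      using caputo_sum_lower_ordered[OF \<alpha> g h ord(1,2) True ord(5) _ gB hB B J N e, of k] incr True
      by auto
    finally show ?thesis .
  next
    case False
    then have st: "s \<le> t" by simp
    have "(N * T powr (-\<alpha>) - e * m powr (-\<alpha>) - 2 * \<alpha> * B * m powr (-\<alpha>-1) * \<bar>t - s\<bar>
        - \<alpha> * k * (T powr (1 - \<alpha>) / (1 - \<alpha>))) / Gamma (1 - \<alpha>) \<le>
       (N * T powr (-\<alpha>) - e * m powr (-\<alpha>) - 2 * \<alpha> * B * m powr (-\<alpha>-1) * (t - s)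
        - \<alpha> * k * (s powr (1 - \<alpha>) / (1 - \<alpha>))) / Gamma (1 - \<alpha>)"
      using False mono[of s] ord G by (intro divide_right_mono) auto
    also have "\<dots> \<le> caputo \<alpha> h s + caputo \<alpha> g t"
    proof (rule caputo_sum_lower_ordered[OF \<alpha> h g ord(1,4) st ord(3) _ hB gB B _ N e])
      show "- k * \<tau> \<le> h s - h (s - \<tau>) + (g t - g (t - \<tau>))" if "0 < \<tau>" "\<tau> < s" for \<tau>
        using incr[of \<tau>] that st by (simp add: add.commute)
    qed (use J in auto)
    finally show ?thesis by simp
  qed
qed

section \<open>Calculus of test functions\<close>

lemma grad_eq:
  assumes "GDERIV f x :> q"
  shows "grad f x = q"
  unfolding grad_def
proof (rule the_equality[where P = "\<lambda>q. GDERIV f x :> q"])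
  fix q' assume "GDERIV f x :> q'"
  then have "(\<lambda>h. h \<bullet> q') = (\<lambda>h. h \<bullet> q)"
    using assms unfolding gderiv_def by (rule has_derivative_unique)
  then have "(q' - q) \<bullet> (q' - q) = 0" by (metis inner_diff_right right_minus_eq)
  then show "q' = q" by simp
qed (rule assms)

lemma C1_on_GDERIV:
  assumes "C1_on UNIV f" obtains q where "GDERIV f x :> q"
  using assms unfolding C1_on_def gderiv_def by auto

lemma C1_on_const: "C1_on S (\<lambda>_. c)"
  unfolding C1_on_def by (rule exI[of _ "\<lambda>_. 0"]) auto

lemma C1_on_add:
  assumes "C1_on S f" "C1_on S g" shows "C1_on S (\<lambda>x. f x + g x)"
proof -
  from assms obtain f' g' where "continuous_on S f'" "continuous_on S g'"
    "\<forall>z\<in>S. (f has_derivative (\<lambda>h. h \<bullet> f' z)) (at z within S)"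
    "\<forall>z\<in>S. (g has_derivative (\<lambda>h. h \<bullet> g' z)) (at z within S)"
    unfolding C1_on_def by blast
  then show ?thesis unfolding C1_on_def
    by (intro exI[of _ "\<lambda>z. f' z + g' z"])
      (auto intro!: continuous_intros has_derivative_add simp: inner_add_right)
qed

lemma C1_on_mult:
  assumes "C1_on S f" "C1_on S g" shows "C1_on S (\<lambda>x. f x * g x)"
proof -
  from assms obtain f' g' where *: "continuous_on S f'" "continuous_on S g'"
    "\<forall>z\<in>S. (f has_derivative (\<lambda>h. h \<bullet> f' z)) (at z within S)"
    "\<forall>z\<in>S. (g has_derivative (\<lambda>h. h \<bullet> g' z)) (at z within S)"
    unfolding C1_on_def by blast
  have c: "continuous_on S f" "continuous_on S g"
    by (rule has_derivative_continuous_on, erule bspec[OF *(3)],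
      rule has_derivative_continuous_on, erule bspec[OF *(4)])
  have "((\<lambda>x. f x * g x) has_derivative (\<lambda>h. h \<bullet> (f z *\<^sub>R g' z + g z *\<^sub>R f' z))) (at z within S)"
    if "z \<in> S" for z
    by (rule has_derivative_eq_rhs[OF has_derivative_mult[OF *(3)[rule_format, OF that] *(4)[rule_format, OF that]]])
      (auto simp: inner_add_right)
  then show ?thesis unfolding C1_on_def
    by (intro exI[of _ "\<lambda>z. f z *\<^sub>R g' z + g z *\<^sub>R f' z"])
      (auto intro!: continuous_intros c *)
qed

lemma C1_on_cmult: "C1_on S f \<Longrightarrow> C1_on S (\<lambda>x. c * f x)"
  by (intro C1_on_mult C1_on_const)

lemma C1_on_minus: "C1_on S f \<Longrightarrow> C1_on S (\<lambda>x. - f x)"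
  using C1_on_cmult[of S f "-1"] by simp

lemma C1_on_diff: "C1_on S f \<Longrightarrow> C1_on S g \<Longrightarrow> C1_on S (\<lambda>x. f x - g x)"
  using C1_on_add[OF _ C1_on_minus, of S f g] by simp

lemma C1_on_compose_fst:
  fixes f :: "'a::real_inner \<Rightarrow> real" and S :: "('a \<times> 'b::real_inner) set"
  assumes "C1_on UNIV f" shows "C1_on S (\<lambda>z. f (fst z))"
proof -
  from assms obtain f' where *: "continuous_on UNIV f'"
    "\<And>z. (f has_derivative (\<lambda>h. h \<bullet> f' z)) (at z)"
    unfolding C1_on_def by auto
  have "((\<lambda>z. f (fst z)) has_derivative (\<lambda>h. h \<bullet> (f' (fst z), 0))) (at z within S)" for z :: "'a \<times> 'b"
    using has_derivative_compose[OF has_derivative_fst[OF has_derivative_ident] *(2)[of "fst z"]]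
    by (simp add: inner_prod_def)
  then show ?thesis unfolding C1_on_def
    by (intro exI[of _ "\<lambda>z. (f' (fst z), 0)"])
      (auto intro!: continuous_intros continuous_on_compose2[OF *(1)])
qed

lemma C1_on_compose_snd:
  fixes f :: "'b::real_inner \<Rightarrow> real" and S :: "('a::real_inner \<times> 'b) set"
  assumes "C1_on UNIV f" shows "C1_on S (\<lambda>z. f (snd z))"
proof -
  from assms obtain f' where *: "continuous_on UNIV f'"
    "\<And>z. (f has_derivative (\<lambda>h. h \<bullet> f' z)) (at z)"
    unfolding C1_on_def by auto
  have "((\<lambda>z. f (snd z)) has_derivative (\<lambda>h. h \<bullet> (0, f' (snd z)))) (at z within S)" for z :: "'a \<times> 'b"
    using has_derivative_compose[OF has_derivative_snd[OF has_derivative_ident] *(2)[of "snd z"]]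
    by (simp add: inner_prod_def)
  then show ?thesis unfolding C1_on_def
    by (intro exI[of _ "\<lambda>z. (0, f' (snd z))"])
      (auto intro!: continuous_intros continuous_on_compose2[OF *(1)])
qed

text \<open>
  Used for the rescaling \<open>x / \<epsilon>\<close> of correctors.
\<close>

lemma C1_on_compose_affine:
  fixes f :: "'a::real_inner \<Rightarrow> real"
  assumes "C1_on UNIV f" shows "C1_on UNIV (\<lambda>x. f (k *\<^sub>R x + a))"
    and "GDERIV f (k *\<^sub>R x + a) :> q \<Longrightarrow> GDERIV (\<lambda>x. f (k *\<^sub>R x + a)) x :> k *\<^sub>R q"
proof -
  have d: "((\<lambda>x. k *\<^sub>R x + a) has_derivative (\<lambda>h. k *\<^sub>R h)) (at x)" for x
    by (auto intro!: derivative_eq_intros)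
  from assms obtain f' where *: "continuous_on UNIV f'"
    "\<And>z. (f has_derivative (\<lambda>h. h \<bullet> f' z)) (at z)"
    unfolding C1_on_def by auto
  have "((\<lambda>x. f (k *\<^sub>R x + a)) has_derivative (\<lambda>h. h \<bullet> (k *\<^sub>R f' (k *\<^sub>R x + a)))) (at x)" for x
    using has_derivative_compose[OF d *(2)] by simp
  then show "C1_on UNIV (\<lambda>x. f (k *\<^sub>R x + a))" unfolding C1_on_def
    by (intro exI[of _ "\<lambda>x. k *\<^sub>R f' (k *\<^sub>R x + a)"])
      (auto intro!: continuous_intros continuous_on_compose2[OF *(1)])
  assume "GDERIV f (k *\<^sub>R x + a) :> q"
  then show "GDERIV (\<lambda>x. f (k *\<^sub>R x + a)) x :> k *\<^sub>R q"
    using has_derivative_compose[OF d, of f _ x] unfolding gderiv_def by fastforce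
qed

lemma GDERIV_sqdist:
  fixes a :: "'a::real_inner"
  shows "GDERIV (\<lambda>x. k * (norm (x - a))\<^sup>2) x :> (2 * k) *\<^sub>R (x - a)"
proof -
  have "((\<lambda>x. k * ((x - a) \<bullet> (x - a))) has_derivative (\<lambda>h. h \<bullet> ((2 * k) *\<^sub>R (x - a)))) (at x)"
    by (auto intro!: derivative_eq_intros simp: inner_commute algebra_simps inner_diff_left inner_diff_right)
  then show ?thesis unfolding gderiv_def power2_norm_eq_inner .
qed

lemma C1_on_sqdist:
  fixes a :: "'a::real_inner"
  shows "C1_on S (\<lambda>x. k * (norm (x - a))\<^sup>2)"
proof -
  have "continuous_on S (\<lambda>x. (2 * k) *\<^sub>R (x - a))" by (intro continuous_intros)
  moreover have "((\<lambda>x. k * (norm (x - a))\<^sup>2) has_derivative (\<lambda>h. h \<bullet> ((2 * k) *\<^sub>R (z - a)))) (at z within S)" for z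
    using GDERIV_sqdist[of k a z] unfolding gderiv_def by (rule has_derivative_at_withinI)
  ultimately show ?thesis unfolding C1_on_def by blast
qed

lemma C1_on_real:
  assumes "\<And>t. (f has_real_derivative f' t) (at t)" "continuous_on UNIV f'"
  shows "C1_on S (f :: real \<Rightarrow> real)"
proof -
  have "(f has_derivative (\<lambda>h. h \<bullet> f' t)) (at t within S)" for t
    using has_derivative_at_withinI[OF assms(1)[of t, unfolded has_field_derivative_def], of S]
    by (rule has_derivative_eq_rhs) (simp add: fun_eq_iff)
  then show ?thesis unfolding C1_on_def
    by (intro exI[of _ f']) (auto intro: continuous_on_subset[OF assms(2)])
qed

lemma C1_on_real_lipschitz:
  fixes f :: "real \<Rightarrow> real"
  assumes "C1_on UNIV f"
  obtains L where "L-lipschitz_on {a..b} f"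
proof -
  from assms obtain f' where *: "continuous_on UNIV f'"
    "\<And>z. (f has_derivative (\<lambda>h. h * f' z)) (at z)"
    unfolding C1_on_def by auto
  have "compact (f' ` {a..b})"
    using continuous_on_subset[OF *(1)] by (intro compact_continuous_image) auto
  then obtain K where K: "\<And>x. x \<in> {a..b} \<Longrightarrow> \<bar>f' x\<bar> \<le> K"
    using compact_imp_bounded[of "f' ` {a..b}"] unfolding bounded_iff by fastforce
  have "(max K 0)-lipschitz_on {a..b} f"
  proof (rule bounded_derivative_imp_lipschitz)
    show "(f has_derivative (\<lambda>h. h * f' x)) (at x within {a..b})" for x
      using *(2) by (rule has_derivative_at_withinI)
    show "onorm (\<lambda>h. h * f' x) \<le> max K 0" if "x \<in> {a..b}" for x
      by (rule onorm_le) (use K[OF that] in \<open>simp add: abs_mult mult.commute[of _ "\<bar>f' x\<bar>"] mult_right_mono le_max_iff_disj\<close>)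
  qed auto
  then show ?thesis by (rule that)
qed

lemma C1_on_imp_continuous_on: "C1_on S f \<Longrightarrow> continuous_on S f"
  unfolding C1_on_def by (elim exE conjE, rule has_derivative_continuous_on) (rule bspec)

section \<open>Time profiles of subsolutions\<close>

text \<open>
  A rational cutoff at scale \<open>r\<close>. It equals 1 at 0 exactly, and for positive \<open>\<tau>\<close>
  both \<open>cutoff r \<tau> * \<tau>\<^sup>2\<close> and \<open>(1 - cutoff r \<tau>) * r\<^sup>2\<close> are at most \<open>r * \<tau> / 2\<close>. So it is small away from 0, and its
  complement is small near 0, in the sense in which the kernel \<open>\<tau> powr (- \<alpha> - 1)\<close> needs it.
\<close>

definition cutoff :: "real \<Rightarrow> real \<Rightarrow> real"
  where "cutoff r \<tau> = r\<^sup>2 / (r\<^sup>2 + \<tau>\<^sup>2)"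

lemma cutoff_bounds:
  assumes "0 < r"
  shows "0 \<le> cutoff r \<tau>" "cutoff r \<tau> \<le> 1" "cutoff r 0 = 1"
  using assms by (auto simp: cutoff_def add_pos_nonneg)

lemma C1_on_cutoff:
  assumes "0 < r" shows "C1_on UNIV (\<lambda>s. cutoff r (s - t))"
proof (rule C1_on_real)
  have nz: "r\<^sup>2 + (s - t)\<^sup>2 \<noteq> 0" for s using assms by (smt (verit) zero_less_power zero_le_power2)
  show "((\<lambda>s. cutoff r (s - t)) has_real_derivative
      - (r\<^sup>2 * (2 * (s - t))) / (r\<^sup>2 + (s - t)\<^sup>2)\<^sup>2) (at s)" for s
    unfolding cutoff_def using nz by (auto intro!: derivative_eq_intros simp: power2_eq_square)
  show "continuous_on UNIV (\<lambda>s. - (r\<^sup>2 * (2 * (s - t))) / (r\<^sup>2 + (s - t)\<^sup>2)\<^sup>2)"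
    using nz by (intro continuous_intros) auto
qed

text \<open>
  Where \<open>\<beta>\<close> touches \<open>U\<close> from above at \<open>t\<close>, this says that the Caputo derivative of \<open>U\<close> at \<open>t\<close>
  is at most \<open>a\<close> in the following relaxed sense: \<open>U\<close> is replaced by \<open>\<beta>\<close> in a window of width
  \<open>r\<close> around \<open>t\<close>, where \<open>U\<close> may be too rough for the singular kernel, and is kept up to
  \<open>\<delta>\<close> outside. The function \<open>g\<close> is a Lipschitz representative of the mixture. Only an upper
  bound for \<open>g\<close> is recorded, since past values enter the Caputo derivative negatively.
\<close>

definition caputo_touch_le ::
    "real \<Rightarrow> real \<Rightarrow> (real \<Rightarrow> real) \<Rightarrow> (real \<Rightarrow> real) \<Rightarrow> real \<Rightarrow> real \<Rightarrow> bool"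
  where "caputo_touch_le \<alpha> T U \<beta> t a \<longleftrightarrow>
    (\<forall>r>0. \<forall>\<delta>>0. \<exists>g L. L-lipschitz_on {0..T} g \<and> g t = U t \<and>
      (\<forall>s\<in>{0..T}. g s \<le> cutoff r (s - t) * \<beta> s + (1 - cutoff r (s - t)) * (U s + \<delta>)) \<and>
      caputo \<alpha> g t \<le> a)"

lemma BUC_on_imp_continuous: "BUC_on S f \<Longrightarrow> continuous_on S f"
  by (simp add: BUC_on_def uniformly_continuous_imp_continuous)

lemma BUC_quadratic_majorant:
  fixes u :: "'a::real_inner \<times> real \<Rightarrow> real" and x :: 'a
  assumes u: "BUC_on (space_time T) u" and d: "0 < \<delta>"
  obtains k where "\<And>(y::'a) s. s \<in> {0..T} \<Longrightarrow> u (y, s) \<le> u (x, s) + \<delta> + k * (norm (y - x))\<^sup>2"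
proof -
  obtain B where B: "\<And>z. z \<in> space_time T \<Longrightarrow> \<bar>u z\<bar> \<le> B"
    using u unfolding BUC_on_def bounded_iff by auto
  obtain \<rho> where \<rho>: "\<rho> > 0" "\<And>z z'. z \<in> space_time T \<Longrightarrow> z' \<in> space_time T \<Longrightarrow> dist z' z < \<rho> \<Longrightarrow>
      dist (u z') (u z) < \<delta>"
    using u d unfolding BUC_on_def uniformly_continuous_on_def by blast
  define k where "k = 2 * max B 0 / \<rho>\<^sup>2"
  have k: "0 \<le> k" by (simp add: k_def)
  show ?thesis
  proof (rule that[of k])
    fix y :: 'a and s assume s: "s \<in> {0..T}"
    have st: "(y, s) \<in> space_time T" "(x, s) \<in> space_time T" using s by (auto simp: space_time_def)
    show "u (y, s) \<le> u (x, s) + \<delta> + k * (norm (y - x))\<^sup>2"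
    proof (cases "norm (y - x) < \<rho>")
      case True
      have "dist (y, s) (x, s) < \<rho>" using True by (simp add: dist_Pair_Pair dist_norm)
      then have "u (y, s) \<le> u (x, s) + \<delta>"
        using \<rho>(2)[OF st(2,1)] by (auto simp: dist_real_def)
      then show ?thesis using k by (simp add: add_increasing2)
    next
      case False
      then have "\<rho>\<^sup>2 \<le> (norm (y - x))\<^sup>2" using \<rho>(1) by (intro power_mono) auto
      then have "k * \<rho>\<^sup>2 \<le> k * (norm (y - x))\<^sup>2" using k by (rule mult_left_mono)
      moreover have "k * \<rho>\<^sup>2 = 2 * max B 0" using \<rho>(1) by (simp add: k_def)
      ultimately show ?thesis using B[OF st(1)] B[OF st(2)] d by linarith
    qed
  qed
qed

text \<open>
  The definition of a subsolution puts the test function into the whole history, but a doubling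
  argument needs the history of \<open>u\<close> itself. The two are reconciled by the test function
  \<open>\<theta> * (\<psi> + \<beta>) + (1 - \<theta>) * (a + \<delta> / 2 + k * (norm (y - x))\<^sup>2)\<close>, where \<open>\<theta>\<close> is a cutoff around
  \<open>t\<close> and \<open>a\<close> is a polynomial that approximates \<open>u (x, _)\<close> by Weierstrass. Uniform continuity
  of \<open>u\<close> provides a \<open>k\<close> for which the second bracket is above \<open>u\<close>. A convex combination of
  functions above \<open>u\<close> is above \<open>u\<close>, and since \<open>\<theta> t = 1\<close> the contact at \<open>(x, t)\<close> and the
  gradient there are those of \<open>\<psi> + \<beta>\<close>.
\<close>

lemma subsolution_touch:
  fixes u :: "'a::real_inner \<times> real \<Rightarrow> real"
  assumes sub: "caputo_subsolution \<alpha> T F u0 u" and buc: "BUC_on (space_time T) u"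
    and \<psi>: "C1_on UNIV \<psi>" "GDERIV \<psi> x :> q" "\<psi> x = 0"
    and \<beta>: "C1_on UNIV \<beta>" and t: "t \<in> {0<..T}"
    and touch: "\<And>y s. s \<in> {0..T} \<Longrightarrow> u (y, s) \<le> \<psi> y + \<beta> s" and eq: "u (x, t) = \<beta> t"
  shows "caputo_touch_le \<alpha> T (\<lambda>s. u (x, s)) \<beta> t (- F x q)"
  unfolding caputo_touch_le_def
proof (intro allI impI)
  fix r \<delta> :: real assume r: "0 < r" and \<delta>: "0 < \<delta>"
  define \<theta> where "\<theta> = (\<lambda>s. cutoff r (s - t))"
  have \<theta>01: "0 \<le> \<theta> s" "\<theta> s \<le> 1" "\<theta> t = 1" for s
    using cutoff_bounds[OF r] by (auto simp: \<theta>_def)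
  have \<theta>C: "C1_on UNIV \<theta>" unfolding \<theta>_def by (rule C1_on_cutoff[OF r])
  obtain k where k: "\<And>y s. s \<in> {0..T} \<Longrightarrow> u (y, s) \<le> u (x, s) + \<delta>/4 + k * (norm (y - x))\<^sup>2"
  proof -
    have "0 < \<delta>/4" using \<delta> by simp
    then show thesis by (rule BUC_quadratic_majorant[OF buc, of "\<delta>/4" x]) (rule that)
  qed
  have "continuous_on {0..T} (\<lambda>s. u (x, s))"
    by (rule continuous_on_compose2[OF BUC_on_imp_continuous[OF buc]])
      (auto intro!: continuous_intros simp: space_time_def)
  then obtain a where a: "real_polynomial_function a" "\<And>s. s \<in> {0..T} \<Longrightarrow> \<bar>u (x, s) - a s\<bar> < \<delta>/4"
    by (rule Stone_Weierstrass_real_polynomial_function[of "{0..T}" "\<lambda>s. u (x, s)" "\<delta>/4", rotated])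
      (use \<delta> in auto)
  obtain a' where a': "real_polynomial_function a'" "\<And>s. (a has_real_derivative a' s) (at s)"
    using has_real_derivative_polynomial_function[OF a(1)] by blast
  have aC: "C1_on UNIV a"
    using a'(2) continuous_on_polymonial_function[of a' UNIV] a'(1)
    by (intro C1_on_real[of a a']) (auto simp: real_polynomial_function_eq)
  define \<phi> where "\<phi> = (\<lambda>z::'a \<times> real. \<theta> (snd z) * (\<psi> (fst z) + \<beta> (snd z)) +
     (1 - \<theta> (snd z)) * ((a (snd z) + \<delta>/2) + k * (norm (fst z - x))\<^sup>2))"
  have C: "C1_on S \<phi>" for S
    unfolding \<phi>_def
    by (intro C1_on_add C1_on_mult C1_on_diff C1_on_const C1_on_compose_fst[OF \<psi>(1)]
        C1_on_compose_snd[OF \<beta>] C1_on_compose_snd[OF aC] C1_on_compose_snd[OF \<theta>C]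
        C1_on_compose_fst[OF C1_on_sqdist])
  have tf: "test_function T \<phi>"
    unfolding test_function_def using C C1_on_imp_continuous_on[OF C] by auto
  have above: "u (y, s) \<le> \<phi> (y, s)" if s: "s \<in> {0..T}" for y s
  proof -
    have "u (y, s) \<le> (a s + \<delta>/2) + k * (norm (y - x))\<^sup>2"
      using k[OF s, of y] a(2)[OF s] by linarith
    then have "(1 - \<theta> s) * u (y, s) \<le> (1 - \<theta> s) * ((a s + \<delta>/2) + k * (norm (y - x))\<^sup>2)"
      using \<theta>01 by (intro mult_left_mono) auto
    moreover have "\<theta> s * u (y, s) \<le> \<theta> s * (\<psi> y + \<beta> s)"
      using touch[OF s] \<theta>01 by (intro mult_left_mono) auto
    ultimately show ?thesis by (simp add: \<phi>_def algebra_simps)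
  qed
  have at: "\<phi> (x, t) = u (x, t)" by (simp add: \<phi>_def \<theta>01 \<psi>(3) eq)
  have max: "\<forall>z\<in>space_time T. u z - \<phi> z \<le> u (x, t) - \<phi> (x, t)"
    using above at by (auto simp: space_time_def)
  have gr: "grad (\<lambda>y. \<phi> (y, t)) x = q"
  proof (rule grad_eq)
    have "GDERIV (\<lambda>y. \<psi> y + \<beta> t) x :> q + 0"
      by (intro GDERIV_add \<psi>(2) GDERIV_const)
    then show "GDERIV (\<lambda>y. \<phi> (y, t)) x :> q" by (simp add: \<phi>_def \<theta>01)
  qed
  define g where "g = (\<lambda>s. \<phi> (x, s))"
  have g_eq: "g s = \<theta> s * \<beta> s + (1 - \<theta> s) * (a s + \<delta>/2)" for s
    by (simp add: g_def \<phi>_def \<psi>(3))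
  have "caputo \<alpha> g t + F x q \<le> 0"
  proof -
    have "caputo_J \<alpha> \<phi> x t + caputo_K \<alpha> 0 t \<phi> x t + F x (grad (\<lambda>y. \<phi> (y, t)) x) \<le> 0"
      using sub tf t max unfolding caputo_subsolution_def by blast
    then show ?thesis by (simp add: caputo_J_plus_K gr g_def)
  qed
  then have le: "caputo \<alpha> g t \<le> - F x q" by simp
  have gt: "g t = u (x, t)" using at by (simp add: g_def)
  have gs: "\<forall>s\<in>{0..T}. g s \<le> \<theta> s * \<beta> s + (1 - \<theta> s) * (u (x, s) + \<delta>)"
  proof
    fix s assume s: "s \<in> {0..T}"
    have "a s + \<delta>/2 \<le> u (x, s) + \<delta>" using a(2)[OF s] \<delta> by linarith
    then show "g s \<le> \<theta> s * \<beta> s + (1 - \<theta> s) * (u (x, s) + \<delta>)"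
      unfolding g_eq using \<theta>01 by (intro add_left_mono mult_left_mono) auto
  qed
  have "C1_on UNIV (\<lambda>s. \<theta> s * \<beta> s + (1 - \<theta> s) * (a s + \<delta>/2))"
    by (intro C1_on_add C1_on_mult C1_on_diff C1_on_const \<beta> aC \<theta>C)
  moreover have "g = (\<lambda>s. \<theta> s * \<beta> s + (1 - \<theta> s) * (a s + \<delta>/2))"
    by (rule ext) (rule g_eq)
  ultimately have "C1_on UNIV g" by simp
  then obtain L where "L-lipschitz_on {0..T} g"
    by (rule C1_on_real_lipschitz)
  then show "\<exists>g L. L-lipschitz_on {0..T} g \<and> g t = u (x, t) \<and>
      (\<forall>s\<in>{0..T}. g s \<le> cutoff r (s - t) * \<beta> s + (1 - cutoff r (s - t)) * (u (x, s) + \<delta>)) \<and>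
      caputo \<alpha> g t \<le> - F x q"
    using le gt gs unfolding \<theta>_def by (intro exI[of _ g] exI[of _ L] conjI)
qed

section \<open>Doubling in time\<close>

lemma cutoff_tail:
  assumes r: "0 < r" "r < 1" and m: "0 < m" "m \<le> \<tau>" and Q: "b - v \<le> Q" "0 \<le> Q"
  shows "cutoff r \<tau> * b + (1 - cutoff r \<tau>) * (v + r\<^sup>2) \<le> v + r * (1 + Q / m\<^sup>2)"
proof -
  have r2: "r\<^sup>2 \<le> r" using r by (simp add: power2_eq_square mult_left_le)
  have c: "cutoff r \<tau> \<le> r\<^sup>2 / m\<^sup>2"
  proof -
    have "m\<^sup>2 \<le> \<tau>\<^sup>2" using m by (intro power_mono) auto
    then have "m\<^sup>2 \<le> r\<^sup>2 + \<tau>\<^sup>2" by (simp add: add_increasing)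
    then show ?thesis unfolding cutoff_def using m r by (intro divide_left_mono) (auto intro!: mult_pos_pos add_pos_nonneg)
  qed
  have "cutoff r \<tau> * b + (1 - cutoff r \<tau>) * (v + r\<^sup>2) = v + r\<^sup>2 + cutoff r \<tau> * (b - v - r\<^sup>2)"
    by (simp add: algebra_simps)
  also have "cutoff r \<tau> * (b - v - r\<^sup>2) \<le> cutoff r \<tau> * Q"
  proof (rule mult_left_mono)
    show "b - v - r\<^sup>2 \<le> Q" using Q(1) zero_le_power2[of r] by linarith
  qed (rule cutoff_bounds(1)[OF r(1)])
  also have "cutoff r \<tau> * Q \<le> (r\<^sup>2 / m\<^sup>2) * Q" using c Q(2) by (rule mult_right_mono)
  also have "\<dots> = r\<^sup>2 * (Q / m\<^sup>2)" by simp
  also have "\<dots> \<le> r * (Q / m\<^sup>2)" using r2 Q(2) by (intro mult_right_mono) auto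
  finally show ?thesis using r2 by (simp add: distrib_left)
qed

lemma cutoff_near:
  assumes r: "0 < r" and \<tau>: "0 < \<tau>"
  shows "cutoff r \<tau> * \<tau>\<^sup>2 \<le> r * \<tau> / 2" and "(1 - cutoff r \<tau>) * r\<^sup>2 \<le> r * \<tau> / 2"
proof -
  have p: "0 < r\<^sup>2 + \<tau>\<^sup>2" using r by (simp add: add_pos_nonneg)
  have ag: "2 * (r * \<tau>) \<le> r\<^sup>2 + \<tau>\<^sup>2"
    using sum_squares_bound[of r \<tau>] by simp
  have *: "r\<^sup>2 * \<tau>\<^sup>2 / (r\<^sup>2 + \<tau>\<^sup>2) \<le> r * \<tau> / 2"
  proof -
    have "r * \<tau> * (2 * (r * \<tau>)) \<le> r * \<tau> * (r\<^sup>2 + \<tau>\<^sup>2)" using ag r \<tau> by (intro mult_left_mono) auto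
    then show ?thesis using p by (simp add: divide_le_eq power2_eq_square mult_ac)
  qed
  show "cutoff r \<tau> * \<tau>\<^sup>2 \<le> r * \<tau> / 2" using * by (simp add: cutoff_def)
  have "1 - cutoff r \<tau> = \<tau>\<^sup>2 / (r\<^sup>2 + \<tau>\<^sup>2)" using p r by (simp add: cutoff_def divide_simps)
  then show "(1 - cutoff r \<tau>) * r\<^sup>2 \<le> r * \<tau> / 2" using * by (simp add: mult.commute)
qed

lemma le_from_linear_error:
  fixes X Y K :: real
  assumes "\<And>r. 0 < r \<Longrightarrow> r < 1 \<Longrightarrow> X - r * K \<le> Y"
  shows "X \<le> Y"
proof (rule field_le_epsilon)
  fix e :: real assume e: "0 < e"
  define r where "r = min (1/2) (e / (\<bar>K\<bar> + 1))"
  have r: "0 < r" "r < 1" using e by (auto simp: r_def)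
  have "r * K \<le> r * (\<bar>K\<bar> + 1)" using r by (intro mult_left_mono) auto
  also have "\<dots> \<le> e / (\<bar>K\<bar> + 1) * (\<bar>K\<bar> + 1)" by (intro mult_right_mono) (auto simp: r_def)
  also have "\<dots> = e" by simp
  finally show "X \<le> Y + e" using assms[OF r] by linarith
qed

text \<open>
  The doubling argument in time for two profiles \<open>U\<close> and \<open>W\<close> that are touched at \<open>t\<close> and
  \<open>s\<close> by the parabolas coming from the penalty \<open>l * (t - s)\<^sup>2\<close>. A common shift of both times by
  \<open>\<tau>\<close> leaves the penalty unchanged, so maximality gives the hypothesis \<open>shift\<close>. With the same
  cutoff in both mixtures, the joint increments are then nonnegative up to
  \<open>r * (l + 1) * \<tau>\<close> if \<open>\<delta> = r\<^sup>2\<close>: the two parabolas lose \<open>2 * l * \<tau>\<^sup>2\<close> in the window, and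
  outside one loses \<open>2 * \<delta>\<close>. Letting \<open>r\<close> tend to 0 for fixed \<open>l\<close> removes this error and
  leaves only the one proportional to \<open>\<bar>t - s\<bar>\<close>, whose factor does not depend on \<open>l\<close>.
\<close>

lemma caputo_doubling:
  assumes \<alpha>: "0 < \<alpha>" "\<alpha> < 1" and l: "0 \<le> l"
    and B: "\<And>r. r \<in> {0..T} \<Longrightarrow> \<bar>U r\<bar> \<le> B" "\<And>r. r \<in> {0..T} \<Longrightarrow> \<bar>W r\<bar> \<le> B"
    and ord: "0 < m" "m \<le> t" "t \<le> T" "m \<le> s" "s \<le> T"
    and shift: "\<And>\<tau>. 0 < \<tau> \<Longrightarrow> \<tau> < t \<Longrightarrow> \<tau> < s \<Longrightarrow> U (t - \<tau>) + W (s - \<tau>) \<le> U t + W s"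
    and U: "caputo_touch_le \<alpha> T U (\<lambda>r. U t + l * ((r - s)\<^sup>2 - (t - s)\<^sup>2)) t a"
    and W: "caputo_touch_le \<alpha> T W (\<lambda>r. W s + l * ((r - t)\<^sup>2 - (s - t)\<^sup>2)) s b"
    and N: "0 \<le> N" "N \<le> (U t - U 0) + (W s - W 0)"
  shows "N * T powr (-\<alpha>) - 4 * \<alpha> * B * m powr (-\<alpha>-1) * \<bar>t - s\<bar> \<le> Gamma (1 - \<alpha>) * (a + b)"
proof -
  have G: "Gamma (1 - \<alpha>) > 0" using \<alpha> by (intro Gamma_real_pos) auto
  have B0: "0 \<le> B" using B(1)[of t] ord by force
  define Q where "Q = 2 * B + l * T\<^sup>2"
  define D where "D = 1 + Q / m\<^sup>2"
  have Q0: "0 \<le> Q" using B0 l by (simp add: Q_def)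
  have D0: "0 \<le> D" using Q0 by (simp add: D_def)
  have tT: "t \<in> {0..T}" "s \<in> {0..T}" using ord by auto
  define K where "K = 2 * D * m powr (-\<alpha>) + 2 * \<alpha> * D * m powr (-\<alpha>-1) * \<bar>t - s\<bar>
      + \<alpha> * (l + 1) * (T powr (1 - \<alpha>) / (1 - \<alpha>))"
  show ?thesis
  proof (rule le_from_linear_error[where K = K])
    fix r :: real assume r: "0 < r" "r < 1"
    define \<theta> where "\<theta> = cutoff r"
    have \<theta>m: "\<theta> (- \<tau>) = \<theta> \<tau>" for \<tau> by (simp add: \<theta>_def cutoff_def)
    have \<theta>01: "0 \<le> \<theta> \<tau>" "\<theta> \<tau> \<le> 1" for \<tau> using cutoff_bounds[OF r(1)] by (auto simp: \<theta>_def)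
    have r2: "0 < r\<^sup>2" using r by simp
    from U r(1) r2 obtain g Lg where g: "Lg-lipschitz_on {0..T} g" "g t = U t" "caputo \<alpha> g t \<le> a"
      and gle: "\<And>q. q \<in> {0..T} \<Longrightarrow> g q \<le> \<theta> (q - t) * (U t + l * ((q - s)\<^sup>2 - (t - s)\<^sup>2)) +
        (1 - \<theta> (q - t)) * (U q + r\<^sup>2)"
      unfolding caputo_touch_le_def \<theta>_def by metis
    from W r(1) r2 obtain h Lh where h: "Lh-lipschitz_on {0..T} h" "h s = W s" "caputo \<alpha> h s \<le> b"
      and hle: "\<And>q. q \<in> {0..T} \<Longrightarrow> h q \<le> \<theta> (q - s) * (W s + l * ((q - t)\<^sup>2 - (s - t)\<^sup>2)) +
        (1 - \<theta> (q - s)) * (W q + r\<^sup>2)"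
      unfolding caputo_touch_le_def \<theta>_def by metis
    have sqT: "(p - q)\<^sup>2 \<le> T\<^sup>2" if "p \<in> {0..T}" "q \<in> {0..T}" for p q :: real
      using that by (intro abs_le_square_iff[THEN iffD1]) auto
    have qb: "l * ((p - q)\<^sup>2 - (p' - q)\<^sup>2) \<le> l * T\<^sup>2" if "p \<in> {0..T}" "q \<in> {0..T}" for p q p' :: real
      using sqT[OF that] l by (intro mult_left_mono) (auto intro: order_trans[rotated])
    have gtail: "g (t - \<tau>) \<le> U (t - \<tau>) + r * D" if "m \<le> \<tau>" "\<tau> \<le> t" for \<tau>
    proof -
      have i: "t - \<tau> \<in> {0..T}" using that ord by auto
      have "U t + l * ((t - \<tau> - s)\<^sup>2 - (t - s)\<^sup>2) - U (t - \<tau>) \<le> Q"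
        using B(1)[OF i] B(1)[OF tT(1)] qb[OF i tT(2), of t] by (simp add: Q_def)
      from cutoff_tail[OF r ord(1) that(1) this Q0] gle[OF i] \<theta>m[of \<tau>]
      show ?thesis by (simp add: \<theta>_def D_def)
    qed
    have htail: "h (s - \<tau>) \<le> W (s - \<tau>) + r * D" if "m \<le> \<tau>" "\<tau> \<le> s" for \<tau>
    proof -
      have i: "s - \<tau> \<in> {0..T}" using that ord by auto
      have "W s + l * ((s - \<tau> - t)\<^sup>2 - (s - t)\<^sup>2) - W (s - \<tau>) \<le> Q"
        using B(2)[OF i] B(2)[OF tT(2)] qb[OF i tT(1), of s] by (simp add: Q_def)
      from cutoff_tail[OF r ord(1) that(1) this Q0] hle[OF i] \<theta>m[of \<tau>]
      show ?thesis by (simp add: \<theta>_def D_def)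
    qed
    have low: "caputo \<alpha> g t + caputo \<alpha> h s \<ge>
      (N * T powr (-\<alpha>) - (2 * r * D) * m powr (-\<alpha>) - 2 * \<alpha> * (2 * B + r * D) * m powr (-\<alpha>-1) * \<bar>t - s\<bar>
      - \<alpha> * (r * (l + 1)) * (T powr (1 - \<alpha>) / (1 - \<alpha>))) / Gamma (1 - \<alpha>)"
    proof (rule caputo_sum_lower[OF \<alpha> g(1) h(1) ord])
      fix \<tau> :: real assume \<tau>: "0 < \<tau>" "\<tau> < t" "\<tau> < s"
      have i: "t - \<tau> \<in> {0..T}" "s - \<tau> \<in> {0..T}" using \<tau> ord by auto
      have "g (t - \<tau>) + h (s - \<tau>) \<le>
        \<theta> \<tau> * (U t + W s + 2 * l * \<tau>\<^sup>2) + (1 - \<theta> \<tau>) * (U (t - \<tau>) + W (s - \<tau>) + 2 * r\<^sup>2)"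
        using gle[OF i(1)] hle[OF i(2)] \<theta>m[of \<tau>] by (simp add: algebra_simps power2_eq_square)
      also have "\<dots> \<le> \<theta> \<tau> * (U t + W s + 2 * l * \<tau>\<^sup>2) + (1 - \<theta> \<tau>) * (U t + W s + 2 * r\<^sup>2)"
        using shift[OF \<tau>] \<theta>01 by (intro add_left_mono mult_left_mono) auto
      also have "\<dots> = U t + W s + 2 * l * (\<theta> \<tau> * \<tau>\<^sup>2) + 2 * ((1 - \<theta> \<tau>) * r\<^sup>2)"
        by (simp add: algebra_simps)
      also have "2 * l * (\<theta> \<tau> * \<tau>\<^sup>2) \<le> 2 * l * (r * \<tau> / 2)"
        using cutoff_near(1)[OF r(1) \<tau>(1)] l by (intro mult_left_mono) (auto simp: \<theta>_def)
      also have "2 * ((1 - \<theta> \<tau>) * r\<^sup>2) \<le> 2 * (r * \<tau> / 2)"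
        using cutoff_near(2)[OF r(1) \<tau>(1)] by (simp add: \<theta>_def)
      finally show "- (r * (l + 1)) * \<tau> \<le> g t - g (t - \<tau>) + (h s - h (s - \<tau>))"
        using g(2) h(2) by (simp add: algebra_simps)
    next
      fix \<tau> assume \<tau>: "m \<le> \<tau>" "\<tau> \<le> t"
      have "t - \<tau> \<in> {0..T}" using \<tau> ord by auto
      from B(1)[OF this] B(1)[OF tT(1)] gtail[OF \<tau>]
      show "- (2 * B + r * D) \<le> g t - g (t - \<tau>)" using g(2) by linarith
    next
      fix \<tau> assume \<tau>: "m \<le> \<tau>" "\<tau> \<le> s"
      have "s - \<tau> \<in> {0..T}" using \<tau> ord by auto
      from B(2)[OF this] B(2)[OF tT(2)] htail[OF \<tau>]
      show "- (2 * B + r * D) \<le> h s - h (s - \<tau>)" using h(2) by linarith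
    next
      show "N - 2 * r * D \<le> g t - g 0 + (h s - h 0)"
        using gtail[of t] htail[of s] ord N(2) g(2) h(2) by simp
    qed (use r l B0 D0 N in auto)
    have "(N * T powr (-\<alpha>) - 4 * \<alpha> * B * m powr (-\<alpha>-1) * \<bar>t - s\<bar> - r * K) / Gamma (1 - \<alpha>) =
      (N * T powr (-\<alpha>) - (2 * r * D) * m powr (-\<alpha>) - 2 * \<alpha> * (2 * B + r * D) * m powr (-\<alpha>-1) * \<bar>t - s\<bar>
      - \<alpha> * (r * (l + 1)) * (T powr (1 - \<alpha>) / (1 - \<alpha>))) / Gamma (1 - \<alpha>)"
      unfolding K_def by (simp add: algebra_simps)
    also have "\<dots> \<le> a + b" using low g(3) h(3) by linarith
    finally show "N * T powr (-\<alpha>) - 4 * \<alpha> * B * m powr (-\<alpha>-1) * \<bar>t - s\<bar> - r * K \<le> Gamma (1 - \<alpha>) * (a + b)"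
      using G by (simp add: pos_divide_le_eq mult.commute)
  qed
qed

section \<open>The perturbed doubling argument\<close>

lemma attains_max_of_bounded_superlevel:
  fixes f :: "'a::heine_borel \<Rightarrow> real"
  assumes S: "closed S" and f: "continuous_on S f" and z0: "z0 \<in> S"
    and bd: "bounded {z \<in> S. f z0 \<le> f z}"
  obtains z where "z \<in> S" "\<And>w. w \<in> S \<Longrightarrow> f w \<le> f z"
proof -
  let ?K = "{z \<in> S. f z0 \<le> f z}"
  have "?K = S \<inter> f -` {f z0..}" by auto
  then have "closed ?K" using continuous_closed_preimage[OF f S, of "{f z0..}"] by simp
  with bd have "compact ?K" by (simp add: compact_eq_bounded_closed)
  moreover have "z0 \<in> ?K" using z0 by simp
  moreover have "continuous_on ?K f" by (rule continuous_on_subset[OF f]) auto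
  ultimately obtain z where z: "z \<in> ?K" "\<And>w. w \<in> ?K \<Longrightarrow> f w \<le> f z"
    using continuous_attains_sup[of ?K f] by blast
  show ?thesis
  proof (rule that)
    show "z \<in> S" using z by simp
    show "f w \<le> f z" if "w \<in> S" for w using z that by (cases "f z0 \<le> f w") auto
  qed
qed

lemma BUC_time_modulus:
  assumes "BUC_on (space_time T) u" "0 < e"
  obtains \<delta> where "0 < \<delta>"
    "\<And>x t s. t \<in> {0..T} \<Longrightarrow> s \<in> {0..T} \<Longrightarrow> \<bar>t - s\<bar> < \<delta> \<Longrightarrow> \<bar>u (x, t) - u (x, s)\<bar> < e"
proof -
  from assms have "uniformly_continuous_on (space_time T) u" by (simp add: BUC_on_def)
  then obtain \<delta> where \<delta>: "\<delta> > 0" and *: "\<forall>z\<in>space_time T. \<forall>z'\<in>space_time T. dist z' z < \<delta> \<longrightarrow>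
      dist (u z') (u z) < e"
    using assms(2) unfolding uniformly_continuous_on_def by blast
  show ?thesis
  proof (rule that[OF \<delta>])
    fix x t s assume "t \<in> {0..T}" "s \<in> {0..T}" "\<bar>t - s\<bar> < \<delta>"
    then show "\<bar>u (x, t) - u (x, s)\<bar> < e"
      using *[rule_format, of "(x, s)" "(x, t)"] by (simp add: space_time_def dist_Pair_Pair dist_real_def)
  qed
qed

lemma BUC_bounded:
  assumes "BUC_on (space_time T) u"
  obtains B where "\<And>x t. t \<in> {0..T} \<Longrightarrow> \<bar>u (x, t)\<bar> \<le> B"
proof -
  obtain B where "\<forall>y\<in>u ` space_time T. norm y \<le> B"
    using assms unfolding BUC_on_def bounded_iff by blast
  then have "\<bar>u (x, t)\<bar> \<le> B" if "t \<in> {0..T}" for x t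
    using that by (simp add: space_time_def)
  then show ?thesis by (rule that)
qed

text \<open>
  The heart of the proof. It is stated for two subsolutions; in the applications one of them is
  the negative of a supersolution, so that \<open>u + w\<close> is the difference to be estimated and
  \<open>- G (- p)\<close> is the Hamiltonian of that supersolution.

  The point \<open>(x0, y0, t0)\<close> maximises \<open>u (x, t) + w (y, t) - (norm (x - y))\<^sup>2 / (2 * \<eta>)\<close> up to
  \<open>e\<close>. Its slope \<open>p0\<close> is frozen, so that a single corrector \<open>v\<close> suffices and no regularity of
  correctors in \<open>p\<close> is involved. Subtracting \<open>v\<close> moves the maximum, but the extra penalty
  \<open>((norm (x - x0))\<^sup>2 + (norm (y - y0))\<^sup>2) / \<eta>\<close> keeps it within distance \<open>d\<close>, because \<open>v\<close>
  changes the functional by at most its oscillation \<open>\<omega>\<close>. Up to the gradient of the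
  corrector, the functions \<open>u\<close> and \<open>w\<close> are hence tested with gradients that differ from \<open>p0\<close>
  and \<open>- p0\<close> by at most \<open>4 * d / \<eta>\<close>, and the equations for \<open>u\<close>,
  \<open>w\<close> and \<open>v\<close> combine to the term \<open>8 * C * d / \<eta>\<close>. As \<open>v\<close> is only continuous, it is given
  a variable \<open>z\<close> of its own; likewise \<open>t\<close> is doubled to \<open>t, s\<close>. Both penalties have the factor
  \<open>l\<close>, which is taken large.
\<close>

lemma perturbed_doubling:
  fixes u w :: "'a::euclidean_space \<times> real \<Rightarrow> real" and v :: "'a \<Rightarrow> real"
  assumes T: "0 < T" and \<alpha>: "0 < \<alpha>" "\<alpha> < 1"
    and u: "caputo_subsolution \<alpha> T F u0 u" "BUC_on (space_time T) u"
    and w: "caputo_subsolution \<alpha> T (\<lambda>_. G) w0 w" "BUC_on (space_time T) w"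
    and F: "\<And>x y p q. \<bar>F x p - F y q\<bar> \<le> C' * norm (x - y) + C * norm (p - q)"
    and G: "\<And>p q. \<bar>G p - G q\<bar> \<le> C * norm (p - q)"
    and v: "continuous_on UNIV v" "\<And>x y. v x - v y \<le> \<omega>"
    and cell: "\<And>\<psi> y. C1_on UNIV \<psi> \<Longrightarrow> (\<And>z. v z - \<psi> z \<ge> v y - \<psi> y) \<Longrightarrow> c \<le> F y (p0 + grad \<psi> y)"
    and \<eta>: "0 < \<eta>" and p0: "p0 = (1 / \<eta>) *\<^sub>R (x0 - y0)" and t0: "t0 \<in> {0..T}"
    and M: "M = u (x0, t0) + w (y0, t0) - (1 / (2 * \<eta>)) * (norm (x0 - y0))\<^sup>2"
    and near: "\<And>x y t. t \<in> {0..T} \<Longrightarrow>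
      u (x, t) + w (y, t) - (1 / (2 * \<eta>)) * (norm (x - y))\<^sup>2 \<le> M + e"
    and d: "0 < d" "\<eta> * (e + \<omega>) < d\<^sup>2"
    and init: "\<And>x y. u (x, 0) + w (y, 0) \<le> A + L * norm (x - y)" and L: "0 \<le> L"
  shows "M \<le> A + \<omega> + L * (norm (x0 - y0) + 2 * d) +
    T powr \<alpha> * Gamma (1 - \<alpha>) * max 0 (- G (- p0) - c + 8 * C * d / \<eta>)"
proof (rule ccontr)
  define Nc where "Nc = max 0 (- G (- p0) - c + 8 * C * d / \<eta>)"
  define \<gamma> where "\<gamma> = M - (A + \<omega> + L * (norm (x0 - y0) + 2 * d) + T powr \<alpha> * Gamma (1 - \<alpha>) * Nc)"
  assume "\<not> ?thesis"
  then have \<gamma>: "0 < \<gamma>" by (simp add: \<gamma>_def Nc_def)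
  have Gam: "0 < Gamma (1 - \<alpha>)" using \<alpha> by (intro Gamma_real_pos) auto
  have Nc0: "0 \<le> Nc" by (simp add: Nc_def)
  have \<omega>0: "0 \<le> \<omega>" using v(2)[of x0 x0] by simp
  have C'0: "0 \<le> C'"
  proof -
    obtain b :: 'a where "b \<in> Basis" using nonempty_Basis by blast
    then show ?thesis using F[of b 0 0 0] abs_ge_zero[of "F b 0 - F 0 0"] by simp
  qed
  have C0: "0 \<le> C"
  proof -
    obtain b :: 'a where "b \<in> Basis" using nonempty_Basis by blast
    then show ?thesis using G[of b 0] abs_ge_zero[of "G b - G 0"] by simp
  qed
  obtain B1 where B1: "\<And>x t. t \<in> {0..T} \<Longrightarrow> \<bar>u (x, t)\<bar> \<le> B1" using BUC_bounded[OF u(2)] by blast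
  obtain B2 where B2: "\<And>x t. t \<in> {0..T} \<Longrightarrow> \<bar>w (x, t)\<bar> \<le> B2" using BUC_bounded[OF w(2)] by blast
  define B where "B = max B1 B2"
  have uB: "\<bar>u (x, t)\<bar> \<le> B" and wB: "\<bar>w (x, t)\<bar> \<le> B" if "t \<in> {0..T}" for x t
    using B1[OF that, of x] B2[OF that, of x] by (auto simp: B_def)
  define \<theta> where "\<theta> = d\<^sup>2 / \<eta> - e - \<omega>"
  have \<theta>: "0 < \<theta>" using d \<eta> by (simp add: \<theta>_def field_simps)
  obtain \<delta>1 where \<delta>1: "0 < \<delta>1"
    "\<And>x t s. t \<in> {0..T} \<Longrightarrow> s \<in> {0..T} \<Longrightarrow> \<bar>t - s\<bar> < \<delta>1 \<Longrightarrow> \<bar>w (x, t) - w (x, s)\<bar> < \<theta>"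
    using BUC_time_modulus[OF w(2) \<theta>] by blast
  have \<gamma>2: "0 < \<gamma> / 2" using \<gamma> by simp
  obtain \<delta>2 where \<delta>2: "0 < \<delta>2"
    "\<And>x t s. t \<in> {0..T} \<Longrightarrow> s \<in> {0..T} \<Longrightarrow> \<bar>t - s\<bar> < \<delta>2 \<Longrightarrow> \<bar>u (x, t) - u (x, s)\<bar> < \<gamma> / 2"
    using BUC_time_modulus[OF u(2) \<gamma>2] by blast
  obtain \<delta>3 where \<delta>3: "0 < \<delta>3"
    "\<And>x t s. t \<in> {0..T} \<Longrightarrow> s \<in> {0..T} \<Longrightarrow> \<bar>t - s\<bar> < \<delta>3 \<Longrightarrow> \<bar>w (x, t) - w (x, s)\<bar> < \<gamma> / 2"
    using BUC_time_modulus[OF w(2) \<gamma>2] by blast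
  \<comment> \<open>If the claim fails by \<open>\<gamma>\<close>, then at times below \<open>2 * m\<close> the function \<open>u + w\<close> is too close to
    its initial values to violate it. So \<open>m\<close> will bound the maximising times from below.\<close>
  define m where "m = min \<delta>2 \<delta>3 / 2"
  have m: "0 < m" using \<delta>2(1) \<delta>3(1) by (simp add: m_def)
  define E where "E = 4 * \<alpha> * B * m powr (-\<alpha>-1) + Gamma (1 - \<alpha>) * C'"
  \<comment> \<open>\<open>\<mu>\<close> will bound \<open>\<bar>t - s\<bar>\<close> and \<open>norm (x - z)\<close>. All errors proportional to it, collected in
    \<open>E * \<mu>\<close>, must not eat up the gain \<open>\<gamma> * T powr - \<alpha>\<close>.\<close>
  define \<mu> where "\<mu> = min (min (\<delta>1 / 2) (m / 2)) (\<gamma> * T powr (-\<alpha>) / (2 * (\<bar>E\<bar> + 1)))"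
  have \<mu>: "0 < \<mu>" "\<mu> < \<delta>1" "\<mu> < m"
    using \<delta>1(1) m \<gamma> T by (auto simp: \<mu>_def intro!: divide_pos_pos mult_pos_pos)
  have E\<mu>: "E * \<mu> < \<gamma> * T powr (-\<alpha>)"
  proof -
    have pos: "0 < \<gamma> * T powr (-\<alpha>)" using \<gamma> T by simp
    have "E * \<mu> \<le> (\<bar>E\<bar> + 1) * \<mu>" using \<mu> by (intro mult_right_mono) auto
    also have "\<dots> \<le> (\<bar>E\<bar> + 1) * (\<gamma> * T powr (-\<alpha>) / (2 * (\<bar>E\<bar> + 1)))"
      by (intro mult_left_mono) (auto simp: \<mu>_def)
    also have "\<dots> = \<gamma> * T powr (-\<alpha>) / 2" by (simp add: field_simps)
    also have "\<dots> < \<gamma> * T powr (-\<alpha>)" using pos by simp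
    finally show ?thesis .
  qed
  define P where "P = 2 * B - M + \<omega>"
  have P0: "0 \<le> P"
    using uB[OF t0, of x0] wB[OF t0, of y0] \<omega>0 \<eta> unfolding P_def M by (simp add: add_increasing2 abs_le_iff) (smt (verit) zero_le_divide_iff zero_le_power2)
  \<comment> \<open>The penalties at the maximum are at most \<open>P\<close>, so this \<open>l\<close> enforces the bounds by \<open>\<mu>\<close>.\<close>
  define l where "l = (P + 1) / \<mu>\<^sup>2"
  have l: "0 < l" using P0 \<mu>(1) by (simp add: l_def)
  have l_small: "a \<le> \<mu>" if "l * a\<^sup>2 \<le> P" for a
  proof (rule power2_le_imp_le)
    have "(P + 1) * a\<^sup>2 \<le> P * \<mu>\<^sup>2" using that \<mu>(1) by (simp add: l_def divide_le_eq)
    also have "\<dots> \<le> (P + 1) * \<mu>\<^sup>2" by (simp add: mult_right_mono)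
    finally show "a\<^sup>2 \<le> \<mu>\<^sup>2" using P0 by simp
  qed (use \<mu> in simp)
  define k where "k = 1 / (2 * \<eta>)"
  define \<kappa> where "\<kappa> = 1 / \<eta>"
  have k: "0 < k" "0 < \<kappa>" "2 * k = 1 / \<eta>" using \<eta> by (auto simp: k_def \<kappa>_def)
  define S where "S = (space_time T :: ('a \<times> real) set) \<times> (space_time T :: ('a \<times> real) set) \<times> (UNIV :: 'a set)"
  define pen where "pen = (\<lambda>Z::('a \<times> real) \<times> ('a \<times> real) \<times> 'a.
      l * (snd (fst Z) - snd (fst (snd Z)))\<^sup>2
      + l * (norm (fst (fst Z) - snd (snd Z)))\<^sup>2
      + \<kappa> * (norm (fst (fst Z) - x0))\<^sup>2 + \<kappa> * (norm (fst (fst (snd Z)) - y0))\<^sup>2)"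
  define \<Phi> where "\<Phi> = (\<lambda>Z::('a \<times> real) \<times> ('a \<times> real) \<times> 'a.
      u (fst Z) + w (fst (snd Z)) - k * (norm (fst (fst Z) - fst (fst (snd Z))))\<^sup>2 - v (snd (snd Z)) - pen Z)"
  define Z0 where "Z0 = ((x0, t0), (y0, t0), x0)"
  have Z0: "Z0 \<in> S" using t0 by (simp add: Z0_def S_def space_time_def)
  have \<Phi>Z0: "\<Phi> Z0 = M - v x0" by (simp add: \<Phi>_def pen_def Z0_def M k_def)
  have pen_le: "pen Z \<le> P" if Z: "Z \<in> S" "\<Phi> Z0 \<le> \<Phi> Z" for Z
  proof -
    obtain x t y s z where Zeq: "Z = ((x, t), (y, s), z)" by (metis prod.exhaust)
    have ts: "t \<in> {0..T}" "s \<in> {0..T}" using Z(1) by (auto simp: S_def Zeq space_time_def)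
    have "0 \<le> k * (norm (x - y))\<^sup>2" using k by simp
    with Z(2) uB[OF ts(1), of x] wB[OF ts(2), of y] v(2)[of x0 z]
    show ?thesis unfolding \<Phi>Z0 P_def by (simp add: \<Phi>_def Zeq)
  qed
  have pen_parts: "l * (t - s)\<^sup>2 \<le> pen ((x, t), (y, s), z)" "l * (norm (x - z))\<^sup>2 \<le> pen ((x, t), (y, s), z)"
     "\<kappa> * (norm (x - x0))\<^sup>2 + \<kappa> * (norm (y - y0))\<^sup>2 \<le> pen ((x, t), (y, s), z)" for x t y s z
    using l k by (auto simp: pen_def add_nonneg_nonneg)
  have bd: "bounded {Z \<in> S. \<Phi> Z0 \<le> \<Phi> Z}"
  proof (rule bounded_subset)
    define R where "R = sqrt (P / \<kappa>)"
    show "bounded ((cball x0 R \<times> {0..T}) \<times> (cball y0 R \<times> {0..T}) \<times> cball x0 (R + \<mu>))"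
      by (intro bounded_Times bounded_cball bounded_closed_interval)
    show "{Z \<in> S. \<Phi> Z0 \<le> \<Phi> Z} \<subseteq> (cball x0 R \<times> {0..T}) \<times> (cball y0 R \<times> {0..T}) \<times> cball x0 (R + \<mu>)"
    proof
      fix Z assume "Z \<in> {Z \<in> S. \<Phi> Z0 \<le> \<Phi> Z}"
      then have ZS: "Z \<in> S" "\<Phi> Z0 \<le> \<Phi> Z" by auto
      obtain x t y s z where Zeq: "Z = ((x, t), (y, s), z)" by (metis prod.exhaust)
      have ts: "t \<in> {0..T}" "s \<in> {0..T}" using ZS(1) by (auto simp: S_def Zeq space_time_def)
      have pl: "pen ((x, t), (y, s), z) \<le> P" using pen_le[OF ZS] by (simp add: Zeq)
      have nn: "0 \<le> \<kappa> * (norm (x - x0))\<^sup>2" "0 \<le> \<kappa> * (norm (y - y0))\<^sup>2" using k by auto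
      have "\<kappa> * (norm (x - x0))\<^sup>2 \<le> P" "\<kappa> * (norm (y - y0))\<^sup>2 \<le> P"
        using pen_parts(3)[of x y t s z] pl nn by linarith+
      then have a: "norm (x - x0) \<le> R" "norm (y - y0) \<le> R"
        unfolding R_def using k(2) by (auto intro!: real_le_rsqrt simp: le_divide_eq mult.commute)
      have b: "norm (x - z) \<le> \<mu>" using l_small pen_parts(2)[of x z t y s] pl by (meson order_trans)
      have "norm (z - x0) \<le> R + \<mu>"
        using norm_triangle_ineq[of "z - x" "x - x0"] a(1) b by (simp add: norm_minus_commute)
      then show "Z \<in> (cball x0 R \<times> {0..T}) \<times> (cball y0 R \<times> {0..T}) \<times> cball x0 (R + \<mu>)"
        using a ts by (simp add: Zeq dist_norm norm_minus_commute)
    qed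
  qed
  have S: "closed S" unfolding S_def space_time_def by (intro closed_Times closed_UNIV closed_atLeastAtMost)
  have cont: "continuous_on S \<Phi>"
  proof -
    have "continuous_on S (\<lambda>Z. u (fst Z))"
      by (rule continuous_on_compose2[OF BUC_on_imp_continuous[OF u(2)]])
        (auto intro!: continuous_intros simp: S_def)
    moreover have "continuous_on S (\<lambda>Z. w (fst (snd Z)))"
      by (rule continuous_on_compose2[OF BUC_on_imp_continuous[OF w(2)]])
        (auto intro!: continuous_intros simp: S_def)
    moreover have "continuous_on S (\<lambda>Z. v (snd (snd Z)))"
      by (rule continuous_on_compose2[OF v(1)]) (auto intro!: continuous_intros)
    moreover have "continuous_on S pen" unfolding pen_def
      by (intro continuous_on_add continuous_on_mult_left continuous_on_power continuous_on_norm
          continuous_on_diff continuous_on_fst continuous_on_snd continuous_on_id continuous_on_const)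
    moreover have "continuous_on S (\<lambda>Z. k * (norm (fst (fst Z) - fst (fst (snd Z))))\<^sup>2)"
      by (intro continuous_on_mult_left continuous_on_power continuous_on_norm
          continuous_on_diff continuous_on_fst continuous_on_snd continuous_on_id)
    ultimately show ?thesis unfolding \<Phi>_def by (intro continuous_on_diff continuous_on_add)
  qed
  obtain Z where Z: "Z \<in> S" and Zmax: "\<And>Y. Y \<in> S \<Longrightarrow> \<Phi> Y \<le> \<Phi> Z"
    by (rule attains_max_of_bounded_superlevel[OF S cont Z0 bd]) (rule that)
  obtain x t y s z where Zeq: "Z = ((x, t), (y, s), z)" by (metis prod.exhaust)
  have ts: "t \<in> {0..T}" "s \<in> {0..T}" using Z by (auto simp: S_def Zeq space_time_def)
  have pl: "pen ((x, t), (y, s), z) \<le> P" using pen_le[OF Z Zmax[OF Z0]] by (simp add: Zeq)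
  have ts\<mu>: "\<bar>t - s\<bar> \<le> \<mu>"
    using l_small[of "\<bar>t - s\<bar>"] pen_parts(1)[of t s x y z] pl by simp
  have xz\<mu>: "norm (x - z) \<le> \<mu>"
    using l_small pen_parts(2)[of x z t y s] pl by (meson order_trans)
  have val: "M - \<omega> \<le> u (x, t) + w (y, s) - k * (norm (x - y))\<^sup>2 - pen ((x, t), (y, s), z)"
    using Zmax[OF Z0] v(2)[of x0 z] unfolding \<Phi>Z0 by (simp add: \<Phi>_def Zeq)
  have pen0: "0 \<le> pen ((x, t), (y, s), z)" and sq0: "0 \<le> k * (norm (x - y))\<^sup>2"
    using l k by (auto simp: pen_def)
  have disp: "norm (x - x0) \<le> d" "norm (y - y0) \<le> d"
  proof -
    have "\<bar>w (y, s) - w (y, t)\<bar> < \<theta>" using \<delta>1(2)[of s t y] ts ts\<mu> \<mu> by simp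
    moreover have "u (x, t) + w (y, t) - k * (norm (x - y))\<^sup>2 \<le> M + e"
      using near[OF ts(1)] by (simp add: k_def)
    ultimately have "\<kappa> * (norm (x - x0))\<^sup>2 + \<kappa> * (norm (y - y0))\<^sup>2 \<le> \<kappa> * d\<^sup>2"
      using val pen_parts(3)[of x y t s z] by (simp add: \<theta>_def \<kappa>_def)
    moreover have "0 \<le> \<kappa> * (norm (x - x0))\<^sup>2" "0 \<le> \<kappa> * (norm (y - y0))\<^sup>2" using k by auto
    ultimately have "\<kappa> * (norm (x - x0))\<^sup>2 \<le> \<kappa> * d\<^sup>2" "\<kappa> * (norm (y - y0))\<^sup>2 \<le> \<kappa> * d\<^sup>2" by linarith+
    then have "(norm (x - x0))\<^sup>2 \<le> d\<^sup>2" "(norm (y - y0))\<^sup>2 \<le> d\<^sup>2" using k(2) by auto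
    then show "norm (x - x0) \<le> d" "norm (y - y0) \<le> d" using d(1) by (auto intro: power2_le_imp_le)
  qed
  have xy: "norm (x - y) \<le> norm (x0 - y0) + 2 * d"
  proof -
    have "x - y = (x - x0) + ((x0 - y0) + (y0 - y))" by simp
    then have "norm (x - y) \<le> norm (x - x0) + (norm (x0 - y0) + norm (y0 - y))"
      by (metis norm_triangle_ineq norm_triangle_le add_left_mono)
    then show ?thesis using disp by (simp add: norm_minus_commute)
  qed
  define N where "N = \<gamma> + T powr \<alpha> * Gamma (1 - \<alpha>) * Nc"
  have TG: "0 \<le> T powr \<alpha> * Gamma (1 - \<alpha>) * Nc" using Gam Nc0 by simp
  have N0: "0 \<le> N" using \<gamma> TG by (simp add: N_def)
  have Nle: "N \<le> (u (x, t) - u (x, 0)) + (w (y, s) - w (y, 0))"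
  proof -
    have "L * norm (x - y) \<le> L * (norm (x0 - y0) + 2 * d)" using xy L by (rule mult_left_mono)
    then show ?thesis using val pen0 sq0 init[of x y] by (simp add: N_def \<gamma>_def)
  qed
  have tsm: "m \<le> t" "m \<le> s"
  proof -
    have "\<not> (t < 2 * m \<and> s < 2 * m)"
    proof
      assume *: "t < 2 * m \<and> s < 2 * m"
      then have "\<bar>u (x, t) - u (x, 0)\<bar> < \<gamma> / 2" "\<bar>w (y, s) - w (y, 0)\<bar> < \<gamma> / 2"
        using \<delta>2(2)[of t 0 x] \<delta>3(2)[of s 0 y] ts T by (auto simp: m_def)
      then show False using Nle TG unfolding N_def by linarith
    qed
    then show "m \<le> t" "m \<le> s" using ts\<mu> \<mu>(3) by linarith+
  qed
  have t0s0: "t \<in> {0<..T}" "s \<in> {0<..T}" using ts tsm m by auto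
  have max: "u (x', t') + w (y', s') - k * (norm (x' - y'))\<^sup>2 - v z' - pen ((x', t'), (y', s'), z')
      \<le> u (x, t) + w (y, s) - k * (norm (x - y))\<^sup>2 - v z - pen ((x, t), (y, s), z)"
    if "t' \<in> {0..T}" "s' \<in> {0..T}" for x' t' y' s' z'
    using Zmax[of "((x', t'), (y', s'), z')"] that by (simp add: \<Phi>_def Zeq S_def space_time_def)
  define q where "q = (2 * l) *\<^sub>R (x - z)"
  \<comment> \<open>The gradients with which \<open>u\<close> and \<open>w\<close> are tested; \<open>q\<close> is the one with which \<open>v\<close> is tested.\<close>
  define g1 where "g1 = (2 * k) *\<^sub>R (x - y) + q + (2 * \<kappa>) *\<^sub>R (x - x0)"
  define g2 where "g2 = (2 * k) *\<^sub>R (y - x) + (2 * \<kappa>) *\<^sub>R (y - y0)"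
  have touch_u: "caputo_touch_le \<alpha> T (\<lambda>r. u (x, r)) (\<lambda>r. u (x, t) + l * ((r - s)\<^sup>2 - (t - s)\<^sup>2)) t (- F x g1)"
  proof -
    define n where "n = (\<lambda>x'. k * (norm (x' - y))\<^sup>2 + l * (norm (x' - z))\<^sup>2 + \<kappa> * (norm (x' - x0))\<^sup>2)"
    show ?thesis
    proof (rule subsolution_touch[OF u])
      show "C1_on UNIV (\<lambda>x'. n x' - n x)"
        unfolding n_def by (rule C1_on_diff, (rule C1_on_add)+, (rule C1_on_sqdist)+, rule C1_on_const)
      have "GDERIV (\<lambda>x'. n x' - n x) x :> g1 - 0"
        unfolding n_def g1_def q_def
        by (rule GDERIV_diff, (rule GDERIV_add)+, (rule GDERIV_sqdist)+, rule GDERIV_const)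
      then show "GDERIV (\<lambda>x'. n x' - n x) x :> g1" by simp
      show "C1_on UNIV (\<lambda>r. u (x, t) + l * ((r - s)\<^sup>2 - (t - s)\<^sup>2))"
        using C1_on_add[OF C1_on_const C1_on_sqdist, of UNIV "u (x, t) - l * (t - s)\<^sup>2" l s]
        by (simp add: algebra_simps)
      show "t \<in> {0<..T}" by (rule t0s0)
      fix x' t' assume t': "t' \<in> {0..T}"
      show "u (x', t') \<le> (n x' - n x) + (u (x, t) + l * ((t' - s)\<^sup>2 - (t - s)\<^sup>2))"
        using max[OF t' ts(2), of x' y z] by (simp add: n_def pen_def algebra_simps)
    qed auto
  qed
  have touch_w: "caputo_touch_le \<alpha> T (\<lambda>r. w (y, r)) (\<lambda>r. w (y, s) + l * ((r - t)\<^sup>2 - (s - t)\<^sup>2)) s (- G g2)"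
  proof -
    define n where "n = (\<lambda>y'. k * (norm (y' - x))\<^sup>2 + \<kappa> * (norm (y' - y0))\<^sup>2)"
    show ?thesis
    proof (rule subsolution_touch[OF w])
      show "C1_on UNIV (\<lambda>y'. n y' - n y)"
        unfolding n_def by (rule C1_on_diff, (rule C1_on_add)+, (rule C1_on_sqdist)+, rule C1_on_const)
      have "GDERIV (\<lambda>y'. n y' - n y) y :> g2 - 0"
        unfolding n_def g2_def
        by (rule GDERIV_diff, (rule GDERIV_add)+, (rule GDERIV_sqdist)+, rule GDERIV_const)
      then show "GDERIV (\<lambda>y'. n y' - n y) y :> g2" by simp
      show "C1_on UNIV (\<lambda>r. w (y, s) + l * ((r - t)\<^sup>2 - (s - t)\<^sup>2))"
        using C1_on_add[OF C1_on_const C1_on_sqdist, of UNIV "w (y, s) - l * (s - t)\<^sup>2" l t]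
        by (simp add: algebra_simps)
      show "s \<in> {0<..T}" by (rule t0s0)
      fix y' s' assume s': "s' \<in> {0..T}"
      show "w (y', s') \<le> (n y' - n y) + (w (y, s) + l * ((s' - t)\<^sup>2 - (s - t)\<^sup>2))"
        using max[OF ts(1) s', of x y' z]
        by (simp add: n_def pen_def norm_minus_commute[of x] power2_commute[of t] algebra_simps)
    qed auto
  qed
  have cell_z: "c \<le> F z (p0 + q)"
  proof -
    have "GDERIV (\<lambda>z'. - l * (norm (z' - x))\<^sup>2) z :> (2 * - l) *\<^sub>R (z - x)"
      by (rule GDERIV_sqdist)
    moreover have "(2 * - l) *\<^sub>R (z - x) = q" by (simp add: q_def algebra_simps)
    ultimately have gr: "grad (\<lambda>z'. - l * (norm (z' - x))\<^sup>2) z = q" by (simp add: grad_eq)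
    have "c \<le> F z (p0 + grad (\<lambda>z'. - l * (norm (z' - x))\<^sup>2) z)"
    proof (rule cell[OF C1_on_sqdist])
      fix z'
      show "v z - - l * (norm (z - x))\<^sup>2 \<le> v z' - - l * (norm (z' - x))\<^sup>2"
        using max[OF ts, of x y z'] by (simp add: pen_def norm_minus_commute[of x])
    qed
    then show ?thesis unfolding gr .
  qed
  have kp: "(2 * k) *\<^sub>R (x0 - y0) = p0" using k(3) p0 by simp
  have g1: "norm (g1 - (p0 + q)) \<le> 4 * d / \<eta>"
  proof -
    have "g1 - (p0 + q) = (2 * k) *\<^sub>R ((x - x0) - (y - y0)) + (2 * \<kappa>) *\<^sub>R (x - x0)"
      unfolding g1_def kp[symmetric] by (simp add: algebra_simps)
    also have "norm \<dots> \<le> (2 * k) * norm ((x - x0) - (y - y0)) + (2 * \<kappa>) * norm (x - x0)"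
      using k(1,2) by (intro norm_triangle_le) simp
    also have "\<dots> \<le> (2 * k) * (2 * d) + (2 * \<kappa>) * d"
      using disp k(1,2) norm_triangle_ineq4[of "x - x0" "y - y0"]
      by (intro add_mono mult_left_mono) auto
    also have "\<dots> = 4 * d / \<eta>" using \<eta> by (simp add: k_def \<kappa>_def field_simps)
    finally show ?thesis .
  qed
  have g2: "norm (g2 - (- p0)) \<le> 4 * d / \<eta>"
  proof -
    have "g2 - (- p0) = (2 * k) *\<^sub>R ((y - y0) - (x - x0)) + (2 * \<kappa>) *\<^sub>R (y - y0)"
      unfolding g2_def kp[symmetric] by (simp add: algebra_simps)
    also have "norm \<dots> \<le> (2 * k) * norm ((y - y0) - (x - x0)) + (2 * \<kappa>) * norm (y - y0)"
      using k(1,2) by (intro norm_triangle_le) simp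
    also have "\<dots> \<le> (2 * k) * (2 * d) + (2 * \<kappa>) * d"
      using disp k(1,2) norm_triangle_ineq4[of "y - y0" "x - x0"]
      by (intro add_mono mult_left_mono) auto
    also have "\<dots> = 4 * d / \<eta>" using \<eta> by (simp add: k_def \<kappa>_def field_simps)
    finally show ?thesis .
  qed
  have ab: "- F x g1 + - G g2 \<le> Nc + C' * \<mu>"
  proof -
    have "\<bar>F x g1 - F z (p0 + q)\<bar> \<le> C' * norm (x - z) + C * norm (g1 - (p0 + q))" by (rule F)
    also have "\<dots> \<le> C' * \<mu> + C * (4 * d / \<eta>)"
      using xz\<mu> g1 C'0 C0 by (intro add_mono mult_left_mono) auto
    finally have 1: "- F x g1 \<le> - c + C' * \<mu> + C * (4 * d / \<eta>)" using cell_z by linarith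
    have "\<bar>G g2 - G (- p0)\<bar> \<le> C * norm (g2 - (- p0))" by (rule G)
    also have "\<dots> \<le> C * (4 * d / \<eta>)" using g2 C0 by (rule mult_left_mono)
    finally have 2: "- G g2 \<le> - G (- p0) + C * (4 * d / \<eta>)" by linarith
    have "- G (- p0) - c + 8 * C * d / \<eta> \<le> Nc" by (simp add: Nc_def)
    then show ?thesis using 1 2 by simp
  qed
  have "N * T powr (-\<alpha>) - 4 * \<alpha> * B * m powr (-\<alpha>-1) * \<bar>t - s\<bar> \<le> Gamma (1 - \<alpha>) * (- F x g1 + - G g2)"
  proof (rule caputo_doubling[OF \<alpha> _ _ _ m tsm(1) _ tsm(2) _ _ touch_u touch_w N0 Nle])
    fix \<tau> assume \<tau>: "0 < \<tau>" "\<tau> < t" "\<tau> < s"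
    have "t - \<tau> \<in> {0..T}" "s - \<tau> \<in> {0..T}" using \<tau> ts by auto
    from max[OF this, of x y z] show "u (x, t - \<tau>) + w (y, s - \<tau>) \<le> u (x, t) + w (y, s)"
      by (simp add: pen_def)
  qed (use ts uB wB l in auto)
  also have "\<dots> \<le> Gamma (1 - \<alpha>) * (Nc + C' * \<mu>)" using ab Gam by (intro mult_left_mono) auto
  finally have fin: "N * T powr (-\<alpha>) \<le> 4 * \<alpha> * B * m powr (-\<alpha>-1) * \<bar>t - s\<bar> + Gamma (1 - \<alpha>) * (Nc + C' * \<mu>)"
    by simp
  have B0: "0 \<le> B" using uB[OF t0, of x0] by linarith
  have "4 * \<alpha> * B * m powr (-\<alpha>-1) * \<bar>t - s\<bar> \<le> 4 * \<alpha> * B * m powr (-\<alpha>-1) * \<mu>"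
    using ts\<mu> \<alpha> B0 by (intro mult_left_mono) auto
  moreover have "N * T powr (-\<alpha>) = \<gamma> * T powr (-\<alpha>) + Gamma (1 - \<alpha>) * Nc"
    using T by (simp add: N_def powr_minus field_simps)
  ultimately have "\<gamma> * T powr (-\<alpha>) \<le> E * \<mu>" using fin by (simp add: E_def algebra_simps)
  then show False using E\<mu> by simp
qed

section \<open>Operations on sub- and supersolutions\<close>

lemma C1_on_max_grad:
  assumes "C1_on UNIV \<psi>" "\<And>z. \<psi> z \<le> \<psi> y"
  shows "grad \<psi> y = 0"
proof -
  obtain q where q: "GDERIV \<psi> y :> q" using C1_on_GDERIV[OF assms(1)] by blast
  have "(\<lambda>h. h \<bullet> q) = (\<lambda>h. 0)"
    by (rule has_derivative_local_max[OF q[unfolded gderiv_def]]) (simp add: assms(2))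
  from fun_cong[OF this, of q] have "q \<bullet> q = 0" .
  then show ?thesis using grad_eq[OF q] by simp
qed

lemma test_function_GDERIV:
  assumes "test_function T \<phi>" "t \<in> {0<..T}"
  obtains q where "GDERIV (\<lambda>y. \<phi> (y, t)) x :> q"
proof -
  obtain g where g: "\<And>z. z \<in> UNIV \<times> {0<..T} \<Longrightarrow>
      (\<phi> has_derivative (\<lambda>h. h \<bullet> g z)) (at z within UNIV \<times> {0<..T})"
    using assms(1) unfolding test_function_def C1_on_def by blast
  have d: "((\<lambda>y. (y, t)) has_derivative (\<lambda>h. (h, 0))) (at x)"
    by (intro has_derivative_Pair has_derivative_ident has_derivative_const)
  have "((\<lambda>y. \<phi> (y, t)) has_derivative (\<lambda>h. (h, 0) \<bullet> g (x, t))) (at x)"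
  proof (rule has_derivative_in_compose[OF d])
    show "(\<phi> has_derivative (\<lambda>h. h \<bullet> g (x, t))) (at (x, t) within range (\<lambda>y. (y, t)))"
      by (rule has_derivative_subset[OF g]) (use assms(2) in auto)
  qed
  then have "GDERIV (\<lambda>y. \<phi> (y, t)) x :> fst (g (x, t))"
    unfolding gderiv_def by (simp add: inner_prod_def)
  then show ?thesis by (rule that)
qed

lemma caputo_minus: "caputo \<alpha> (\<lambda>s. - g s) t = - caputo \<alpha> g t"
proof -
  have m: "(- p - - q) / r = - ((p - q) / r)" for p q r :: real
    by (metis minus_diff_minus minus_divide_left)
  have "(LBINT \<tau>:{0<..<t}. - ((g t - g (t - \<tau>)) / \<tau> powr (\<alpha> + 1))) =
    - (LBINT \<tau>:{0<..<t}. (g t - g (t - \<tau>)) / \<tau> powr (\<alpha> + 1))"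
    unfolding set_lebesgue_integral_def scaleR_minus_right by (rule Bochner_Integration.integral_minus)
  then show ?thesis unfolding caputo_def m by (simp only: minus_add_distrib mult_minus_right)
qed

lemma test_function_minus: "test_function T \<phi> \<Longrightarrow> test_function T (\<lambda>z. - \<phi> z)"
  unfolding test_function_def using C1_on_minus continuous_on_minus by blast

text \<open>
  The Caputo derivative is linear, so reflection exchanges sub- and supersolutions. This is what
  allows all estimates to be stated for pairs of subsolutions and used in both directions. The
  gradient of the reflected test function has to be known to exist, as \<open>grad\<close> is defined by a
  description.
\<close>

lemma supersolution_uminus:
  assumes "caputo_supersolution \<alpha> T F u0 u"
  shows "caputo_subsolution \<alpha> T (\<lambda>x p. - F x (- p)) (\<lambda>x. - u0 x) (\<lambda>z. - u z)"
  unfolding caputo_subsolution_def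
proof (intro conjI allI impI)
  have "{z \<in> space_time T. - u z < c} = {z \<in> space_time T. - c < u z}" for c by auto
  then show "usc_on (space_time T) (\<lambda>z. - u z)"
    using assms unfolding usc_on_def caputo_supersolution_def lsc_on_def by simp
  show "- u (x, 0) \<le> - u0 x" for x using assms unfolding caputo_supersolution_def by simp
  fix \<phi> x t
  assume \<phi>: "test_function T \<phi>" and t: "t \<in> {0<..T}"
    and max: "\<forall>z\<in>space_time T. - u z - \<phi> z \<le> - u (x, t) - \<phi> (x, t)"
  have min: "\<forall>z\<in>space_time T. u z - - \<phi> z \<ge> u (x, t) - - \<phi> (x, t)" using max by auto
  obtain q where q: "GDERIV (\<lambda>y. \<phi> (y, t)) x :> q" by (rule test_function_GDERIV[OF \<phi> t])
  have "0 \<le> caputo_J \<alpha> (\<lambda>z. - \<phi> z) x t + caputo_K \<alpha> 0 t (\<lambda>z. - \<phi> z) x t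
      + F x (grad (\<lambda>y. - \<phi> (y, t)) x)"
    using assms test_function_minus[OF \<phi>] t min unfolding caputo_supersolution_def by blast
  then show "caputo_J \<alpha> \<phi> x t + caputo_K \<alpha> 0 t \<phi> x t + - F x (- grad (\<lambda>y. \<phi> (y, t)) x) \<le> 0"
    unfolding caputo_J_plus_K caputo_minus grad_eq[OF q] grad_eq[OF GDERIV_minus[OF q]] by simp
qed

lemma BUC_on_uminus: "BUC_on S u \<Longrightarrow> BUC_on S (\<lambda>z. - u z)"
  unfolding BUC_on_def by (auto intro: uniformly_continuous_on_minus simp: bounded_iff)

lemma usc_on_continuous: "continuous_on S f \<Longrightarrow> usc_on S f"
  unfolding usc_on_def
proof
  fix c assume f: "continuous_on S f"
  have "openin (top_of_set S) (S \<inter> f -` {..<c})"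
    by (rule continuous_openin_preimage_gen[OF f]) simp
  moreover have "S \<inter> f -` {..<c} = {z \<in> S. f z < c}" by auto
  ultimately show "openin (top_of_set S) {z \<in> S. f z < c}" by simp
qed

text \<open>
  Taken as the second function in the doubling argument, the zero function yields a priori upper
  bounds for a single subsolution.
\<close>

lemma zero_subsolution:
  assumes \<alpha>: "0 < \<alpha>" "\<alpha> < 1" and T: "0 < T"
  shows "caputo_subsolution \<alpha> T (\<lambda>_ _. 0) (\<lambda>_. 0) (\<lambda>_ :: 'a::real_inner \<times> real. 0)"
  unfolding caputo_subsolution_def
proof (intro conjI allI impI)
  show "usc_on (space_time T) (\<lambda>_ :: 'a \<times> real. 0)" by (rule usc_on_continuous) simp
  fix \<phi> :: "'a \<times> real \<Rightarrow> real" and x t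
  assume t: "t \<in> {0<..T}" and max: "\<forall>z\<in>space_time T. 0 - \<phi> z \<le> 0 - \<phi> (x, t)"
  have G: "Gamma (1 - \<alpha>) > 0" using \<alpha> by (intro Gamma_real_pos) auto
  have le: "\<phi> (x, t) \<le> \<phi> (x, s)" if "s \<in> {0..T}" for s
    using max that by (auto simp: space_time_def)
  have "caputo_J \<alpha> \<phi> x t \<le> 0"
    unfolding caputo_J_def using le[of 0] T G by (intro divide_nonpos_nonneg) auto
  moreover have "0 \<le> (LBINT \<tau>:{0<..<t}. - ((\<phi> (x, t) - \<phi> (x, t - \<tau>)) / \<tau> powr (\<alpha> + 1)))"
    unfolding set_lebesgue_integral_def
  proof (rule Bochner_Integration.integral_nonneg)
    fix \<tau> :: real
    show "0 \<le> indicat_real {0<..<t} \<tau> *\<^sub>R - ((\<phi> (x, t) - \<phi> (x, t - \<tau>)) / \<tau> powr (\<alpha> + 1))"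
      using le[of "t - \<tau>"] t by (auto simp: indicator_def divide_nonpos_nonneg)
  qed
  then have "(LBINT \<tau>:{0<..<t}. (\<phi> (x, t) - \<phi> (x, t - \<tau>)) / \<tau> powr (\<alpha> + 1)) \<le> 0"
    unfolding set_lebesgue_integral_def by simp
  then have "caputo_K \<alpha> 0 t \<phi> x t \<le> 0"
    unfolding caputo_K_def using \<alpha> G by (intro mult_nonneg_nonpos) auto
  ultimately show "caputo_J \<alpha> \<phi> x t + caputo_K \<alpha> 0 t \<phi> x t + 0 \<le> 0" by simp
qed simp

lemma BUC_translate:
  fixes u :: "'a::real_inner \<times> real \<Rightarrow> real"
  assumes "BUC_on (space_time T) u"
  shows "BUC_on (space_time T) (\<lambda>z. u (fst z + h, snd z))"
  unfolding BUC_on_def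
proof
  let ?s = "\<lambda>z::'a \<times> real. (fst z + h, snd z)"
  have im: "?s ` space_time T \<subseteq> space_time T" by (auto simp: space_time_def)
  have "bounded (u ` space_time T)" using assms by (simp add: BUC_on_def)
  then show "bounded ((\<lambda>z. u (?s z)) ` space_time T)"
    by (rule bounded_subset) (use im in blast)
  show "uniformly_continuous_on (space_time T) (\<lambda>z. u (?s z))"
    unfolding uniformly_continuous_on_def
  proof (intro allI impI)
    fix e :: real assume "0 < e"
    then obtain d where d: "0 < d" "\<forall>z\<in>space_time T. \<forall>z'\<in>space_time T. dist z' z < d \<longrightarrow> dist (u z') (u z) < e"
      using assms unfolding BUC_on_def uniformly_continuous_on_def by blast
    have "dist (u (?s z')) (u (?s z)) < e"
      if "z \<in> space_time T" "z' \<in> space_time T" "dist z' z < d" for z z'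
      using d(2)[rule_format, of "?s z" "?s z'"] that by (auto simp: space_time_def dist_prod_def)
    with d(1) show "\<exists>d>0. \<forall>z\<in>space_time T. \<forall>z'\<in>space_time T. dist z' z < d \<longrightarrow>
        dist (u (?s z')) (u (?s z)) < e" by blast
  qed
qed

lemma subsolution_translate:
  fixes u :: "'a::real_inner \<times> real \<Rightarrow> real"
  assumes sub: "caputo_subsolution \<alpha> T (\<lambda>_. F) u0 u" and buc: "BUC_on (space_time T) u"
  shows "caputo_subsolution \<alpha> T (\<lambda>_. F) (\<lambda>x. u0 (x + h)) (\<lambda>z. u (fst z + h, snd z))"
  unfolding caputo_subsolution_def
proof (intro conjI allI impI)
  show "usc_on (space_time T) (\<lambda>z. u (fst z + h, snd z))"
    by (intro usc_on_continuous BUC_on_imp_continuous BUC_translate buc)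
  show "u (fst (x, 0::real) + h, snd (x, 0::real)) \<le> u0 (x + h)" for x
    using sub by (simp add: caputo_subsolution_def)
  fix \<phi> :: "'a \<times> real \<Rightarrow> real" and x t
  assume \<phi>: "test_function T \<phi>" and t: "t \<in> {0<..T}"
    and max: "\<forall>z\<in>space_time T. u (fst z + h, snd z) - \<phi> z \<le>
      u (fst (x, t) + h, snd (x, t)) - \<phi> (x, t)"
  define \<rho> where "\<rho> = (\<lambda>z. \<phi> (z + (-h, 0)))"
  have shift: "(\<lambda>z. z + (-h, 0)) ` (UNIV \<times> I) = UNIV \<times> I" for I :: "real set"
  proof -
    have "(a, b) \<in> (\<lambda>z. z + (-h, 0)) ` (UNIV \<times> I)" if "b \<in> I" for a b
      by (rule image_eqI[of _ _ "(a + h, b)"]) (use that in auto)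
    then show ?thesis by auto
  qed
  have tf: "test_function T \<rho>"
    unfolding test_function_def
  proof
    obtain g where g: "continuous_on (UNIV \<times> {0<..T}) g" "\<And>z. z \<in> UNIV \<times> {0<..T} \<Longrightarrow>
        (\<phi> has_derivative (\<lambda>k. k \<bullet> g z)) (at z within UNIV \<times> {0<..T})"
      using \<phi> unfolding test_function_def C1_on_def by blast
    have "(\<rho> has_derivative (\<lambda>k. k \<bullet> g (z + (-h, 0)))) (at z within UNIV \<times> {0<..T})"
      if z: "z \<in> UNIV \<times> {0<..T}" for z
    proof -
      have d: "((\<lambda>z. z + (-h, 0)) has_derivative (\<lambda>k. k)) (at z within UNIV \<times> {0<..T})"
        by (auto intro!: derivative_eq_intros)
      have z': "z + (-h, 0) \<in> UNIV \<times> {0<..T}" using z by (auto simp: plus_prod_def)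
      show ?thesis unfolding \<rho>_def
        by (rule has_derivative_in_compose[OF d]) (simp only: shift g(2)[OF z'])
    qed
    moreover have "continuous_on (UNIV \<times> {0<..T}) (\<lambda>z. g (z + (-h, 0)))"
      by (rule continuous_on_compose2[OF g(1)]) (auto intro!: continuous_intros simp: plus_prod_def)
    ultimately show "C1_on (UNIV \<times> {0<..T}) \<rho>" unfolding C1_on_def by blast
    have "continuous_on (space_time T) \<phi>" using \<phi> by (simp add: test_function_def)
    then show "continuous_on (space_time T) \<rho>" unfolding \<rho>_def
      by (rule continuous_on_compose2) (auto intro!: continuous_intros simp: plus_prod_def space_time_def)
  qed
  have \<rho>: "\<rho> (y, s) = \<phi> (y - h, s)" for y s by (simp add: \<rho>_def)
  have "\<forall>z\<in>space_time T. u z - \<rho> z \<le> u (x + h, t) - \<rho> (x + h, t)"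
  proof
    fix z :: "'a \<times> real" assume z: "z \<in> space_time T"
    then have "(fst z - h, snd z) \<in> space_time T" by (auto simp: space_time_def)
    from max[rule_format, OF this] show "u z - \<rho> z \<le> u (x + h, t) - \<rho> (x + h, t)"
      using \<rho>[of "fst z" "snd z"] by (simp add: \<rho>)
  qed
  then have le: "caputo_J \<alpha> \<rho> (x + h) t + caputo_K \<alpha> 0 t \<rho> (x + h) t
      + F (grad (\<lambda>y. \<rho> (y, t)) (x + h)) \<le> 0"
    using sub tf t unfolding caputo_subsolution_def by blast
  obtain q where q: "GDERIV (\<lambda>y. \<phi> (y, t)) x :> q" by (rule test_function_GDERIV[OF \<phi> t])
  have "GDERIV (\<lambda>y. \<rho> (y, t)) (x + h) :> q"
  proof -
    have d: "((\<lambda>y. y - h) has_derivative (\<lambda>k. k)) (at (x + h))"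
      by (auto intro!: derivative_eq_intros)
    show ?thesis using has_derivative_compose[OF d, of "\<lambda>y. \<phi> (y, t)"] q
      unfolding gderiv_def \<rho> by simp
  qed
  then show "caputo_J \<alpha> \<phi> x t + caputo_K \<alpha> 0 t \<phi> x t + F (grad (\<lambda>y. \<phi> (y, t)) x) \<le> 0"
    using le grad_eq[OF q] unfolding caputo_J_plus_K by (simp add: grad_eq \<rho>)
qed

lemma near_maximiser:
  fixes u w :: "'a::euclidean_space \<times> real \<Rightarrow> real"
  assumes "BUC_on (space_time T) u" "BUC_on (space_time T) w" and T: "0 < T" and k: "0 \<le> k" and e: "0 < e"
  obtains x0 y0 t0 where "t0 \<in> {0..T}"
    "\<And>x y t. t \<in> {0..T} \<Longrightarrow> u (x, t) + w (y, t) - k * (norm (x - y))\<^sup>2 \<le>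
      u (x0, t0) + w (y0, t0) - k * (norm (x0 - y0))\<^sup>2 + e"
proof -
  obtain B1 where B1: "\<And>x t. t \<in> {0..T} \<Longrightarrow> \<bar>u (x, t)\<bar> \<le> B1" using BUC_bounded[OF assms(1)] by blast
  obtain B2 where B2: "\<And>x t. t \<in> {0..T} \<Longrightarrow> \<bar>w (x, t)\<bar> \<le> B2" using BUC_bounded[OF assms(2)] by blast
  define f where "f = (\<lambda>(x, y, t). u (x, t) + w (y, t) - k * (norm (x - y))\<^sup>2)"
  define S where "S = (UNIV :: 'a set) \<times> (UNIV :: 'a set) \<times> {0..T}"
  have "f z \<le> B1 + B2" if "z \<in> S" for z
  proof -
    obtain x y t where z: "z = (x, y, t)" by (metis prod.exhaust)
    have t: "t \<in> {0..T}" using that by (simp add: z S_def)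
    have "0 \<le> k * (norm (x - y))\<^sup>2" using k by simp
    then show ?thesis using B1[OF t, of x] B2[OF t, of y] by (simp add: f_def z)
  qed
  then have bdd: "bdd_above (f ` S)" by (intro bdd_aboveI2)
  have "S \<noteq> {}" using T by (auto simp: S_def)
  then have "\<exists>y\<in>f ` S. Sup (f ` S) - e < y"
    by (intro less_cSup_iff[OF _ bdd, THEN iffD1]) (use e in simp_all)
  then obtain z where z: "z \<in> S" "Sup (f ` S) - e < f z" by blast
  obtain x0 y0 t0 where zeq: "z = (x0, y0, t0)" by (metis prod.exhaust)
  show ?thesis
  proof (rule that[of t0 x0 y0])
    show "t0 \<in> {0..T}" using z by (simp add: zeq S_def)
    fix x y t assume "t \<in> {0..T}"
    then have "f (x, y, t) \<le> Sup (f ` S)" by (intro cSup_upper bdd) (auto simp: S_def)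
    then show "u (x, t) + w (y, t) - k * (norm (x - y))\<^sup>2 \<le>
      u (x0, t0) + w (y0, t0) - k * (norm (x0 - y0))\<^sup>2 + e"
      using z(2) by (simp add: zeq f_def)
  qed
qed

section \<open>The cell problem\<close>

lemma integer_shift_into_box:
  fixes x :: "real^'n"
  obtains k where "\<And>i. k $ i \<in> \<int>" "x + k \<in> cbox 0 1" "norm (x + k) \<le> real CARD('n)"
proof -
  define k :: "real^'n" where "k = (\<chi> i. - of_int \<lfloor>x $ i\<rfloor>)"
  have c: "0 \<le> (x + k) $ i" "(x + k) $ i \<le> 1" for i
    unfolding k_def vector_add_component vec_lambda_beta by linarith+
  have "norm (x + k) \<le> (\<Sum>i\<in>UNIV. \<bar>(x + k) $ i\<bar>)" by (rule norm_le_l1_cart)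
  also have "\<dots> \<le> (\<Sum>i\<in>(UNIV :: 'n set). 1)"
    by (rule sum_mono) (use c in \<open>simp add: abs_le_iff\<close>)
  finally have "norm (x + k) \<le> real CARD('n)" by simp
  moreover have "x + k \<in> cbox 0 1" using c by (simp add: mem_box_cart)
  moreover have "k $ i \<in> \<int>" for i by (simp add: k_def)
  ultimately show ?thesis by (intro that)
qed

lemma periodic_bounded:
  fixes v :: "real^'n \<Rightarrow> real"
  assumes "continuous_on UNIV v" "integer_periodic v"
  obtains B where "\<And>x. \<bar>v x\<bar> \<le> B"
proof -
  have "compact (v ` cbox 0 1)"
    by (intro compact_continuous_image continuous_on_subset[OF assms(1)]) auto
  then have "bounded (v ` cbox 0 1)" by (rule compact_imp_bounded)
  then obtain B where B: "\<And>x. x \<in> cbox 0 1 \<Longrightarrow> \<bar>v x\<bar> \<le> B"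
    unfolding bounded_iff by (auto simp only: ball_simps real_norm_def)
  have "\<bar>v x\<bar> \<le> B" for x
  proof -
    obtain k where k: "\<And>i. k $ i \<in> \<int>" "x + k \<in> cbox 0 1" by (rule integer_shift_into_box[of x]) blast
    have "v (x + k) = v x" using assms(2) k(1) by (simp add: integer_periodic_def)
    with B[OF k(2)] show ?thesis by simp
  qed
  then show ?thesis by (rule that)
qed

text \<open>
  The cone \<open>K * norm (z - y)\<close> is not differentiable at its apex; this is its smoothing at scale
  \<open>\<delta>\<close>.
\<close>

lemma GDERIV_smoothed_cone:
  fixes y :: "'a::real_inner"
  assumes "0 < \<delta>"
  shows "GDERIV (\<lambda>z. K * sqrt (\<delta>\<^sup>2 + (norm (z - y))\<^sup>2)) z :>
    (K / sqrt (\<delta>\<^sup>2 + (norm (z - y))\<^sup>2)) *\<^sub>R (z - y)"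
proof -
  let ?a = "\<delta>\<^sup>2 + (norm (z - y))\<^sup>2"
  have pos: "0 < ?a" using assms by (simp add: add_pos_nonneg)
  have "GDERIV (\<lambda>z. \<delta>\<^sup>2 + 1 * (norm (z - y))\<^sup>2) z :> 0 + (2 * 1) *\<^sub>R (z - y)"
    by (rule GDERIV_add[OF GDERIV_const GDERIV_sqdist])
  then have "GDERIV (\<lambda>z. \<delta>\<^sup>2 + (norm (z - y))\<^sup>2) z :> 2 *\<^sub>R (z - y)"
    by (simp only: mult_1 mult_1_right add_0)
  moreover have "DERIV (\<lambda>s. K * sqrt s) ?a :> K * (inverse (sqrt ?a) / 2)"
    by (rule DERIV_cmult[OF DERIV_real_sqrt[OF pos]])
  ultimately have "GDERIV (\<lambda>z. K * sqrt (\<delta>\<^sup>2 + (norm (z - y))\<^sup>2)) z :>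
      (K * (inverse (sqrt ?a) / 2)) *\<^sub>R 2 *\<^sub>R (z - y)"
    by (rule GDERIV_DERIV_compose)
  moreover have "(K * (inverse s / 2)) * 2 = K / s" for s :: real
    by (simp add: inverse_eq_divide)
  ultimately show ?thesis by (simp only: scaleR_scaleR)
qed

lemma C1_on_smoothed_cone:
  fixes y :: "'a::real_inner"
  assumes "0 < \<delta>"
  shows "C1_on UNIV (\<lambda>z. K * sqrt (\<delta>\<^sup>2 + (norm (z - y))\<^sup>2))"
proof -
  have nz: "sqrt (\<delta>\<^sup>2 + (norm (z - y))\<^sup>2) \<noteq> 0" for z
    using assms by (simp add: add_nonneg_eq_0_iff)
  have "continuous_on UNIV (\<lambda>z. K / sqrt (\<delta>\<^sup>2 + (norm (z - y))\<^sup>2))"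
    using nz by (intro continuous_on_divide continuous_on_real_sqrt continuous_on_add continuous_on_power
        continuous_on_norm continuous_on_diff continuous_on_id continuous_on_const) auto
  then have "continuous_on UNIV (\<lambda>z. (K / sqrt (\<delta>\<^sup>2 + (norm (z - y))\<^sup>2)) *\<^sub>R (z - y))"
    by (intro continuous_on_scaleR continuous_on_diff continuous_on_id continuous_on_const)
  then show ?thesis unfolding C1_on_def
    using GDERIV_smoothed_cone[OF assms, of K y, unfolded gderiv_def] by blast
qed

text \<open>
  Viscosity subsolutions of \<open>norm (grad v) \<le> K\<close> are Lipschitz. The smoothed cone with slope
  \<open>2 * K\<close> has a gradient larger than \<open>K\<close> outside the ball of radius \<open>\<delta>\<close>, so it can touch \<open>v\<close>
  only within that ball, where \<open>v\<close> is close to \<open>v y\<close>. The slope is doubled because a cone of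
  slope \<open>K\<close> never gets steeper than \<open>K\<close> after smoothing.
\<close>

lemma periodic_subsolution_lipschitz:
  fixes v :: "real^'n \<Rightarrow> real"
  assumes v: "continuous_on UNIV v" "integer_periodic v" and K: "0 < K"
    and sub: "\<And>\<psi> y. C1_on UNIV \<psi> \<Longrightarrow> (\<And>z. v z - \<psi> z \<le> v y - \<psi> y) \<Longrightarrow> norm (grad \<psi> y) \<le> K"
  shows "v x - v y \<le> 2 * K * norm (x - y)"
proof (rule field_le_epsilon)
  fix e :: real assume e: "0 < e"
  obtain B where B: "\<And>x. \<bar>v x\<bar> \<le> B" using periodic_bounded[OF v] by blast
  have "continuous (at y) v" using v(1) by (simp add: continuous_on_eq_continuous_at)
  then obtain \<delta>0 where \<delta>0: "0 < \<delta>0" "\<And>z. dist z y < \<delta>0 \<Longrightarrow> dist (v z) (v y) < e / 2"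
    using e unfolding continuous_at_eps_delta by (metis half_gt_zero)
  define \<delta> where "\<delta> = min (\<delta>0 / 2) (e / (4 * K))"
  have \<delta>: "0 < \<delta>" "\<delta> < \<delta>0" using \<delta>0(1) e K by (auto simp: \<delta>_def)
  have K\<delta>: "2 * K * \<delta> \<le> e / 2"
  proof -
    have "2 * K * \<delta> \<le> 2 * K * (e / (4 * K))" using K by (intro mult_left_mono) (auto simp: \<delta>_def)
    then show ?thesis using K by simp
  qed
  define \<psi> where "\<psi> = (\<lambda>z. 2 * K * sqrt (\<delta>\<^sup>2 + (norm (z - y))\<^sup>2))"
  have C: "C1_on UNIV \<psi>" unfolding \<psi>_def by (rule C1_on_smoothed_cone[OF \<delta>(1)])
  have bd: "bounded {z \<in> UNIV. v y - \<psi> y \<le> v z - \<psi> z}"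
  proof (rule bounded_subset)
    show "bounded (cball y ((2 * B + \<psi> y) / (2 * K)))" by (rule bounded_cball)
    show "{z \<in> UNIV. v y - \<psi> y \<le> v z - \<psi> z} \<subseteq> cball y ((2 * B + \<psi> y) / (2 * K))"
    proof
      fix z assume "z \<in> {z \<in> UNIV. v y - \<psi> y \<le> v z - \<psi> z}"
      then have "\<psi> z \<le> 2 * B + \<psi> y" using B[of z] B[of y] by (simp add: abs_le_iff)
      moreover have "norm (z - y) \<le> sqrt (\<delta>\<^sup>2 + (norm (z - y))\<^sup>2)" by (rule real_le_rsqrt) simp
      then have "2 * K * norm (z - y) \<le> \<psi> z" unfolding \<psi>_def using K by (intro mult_left_mono) auto
      ultimately have "2 * K * norm (z - y) \<le> 2 * B + \<psi> y" by linarith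
      then show "z \<in> cball y ((2 * B + \<psi> y) / (2 * K))"
        using K by (simp add: dist_norm norm_minus_commute le_divide_eq mult.commute)
    qed
  qed
  have cont: "continuous_on UNIV (\<lambda>z. v z - \<psi> z)"
    using v(1) C1_on_imp_continuous_on[OF C] by (rule continuous_on_diff)
  obtain z where z: "\<And>z'. v z' - \<psi> z' \<le> v z - \<psi> z"
    by (rule attains_max_of_bounded_superlevel[OF closed_UNIV cont UNIV_I bd]) (rule that, simp)
  let ?s = "sqrt (\<delta>\<^sup>2 + (norm (z - y))\<^sup>2)"
  have s: "0 < ?s" using \<delta>(1) by (simp add: add_pos_nonneg)
  have "grad \<psi> z = (2 * K / ?s) *\<^sub>R (z - y)"
    unfolding \<psi>_def by (rule grad_eq[OF GDERIV_smoothed_cone[OF \<delta>(1)]])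
  with sub[OF C z] have "2 * K / ?s * norm (z - y) \<le> K" using K s by simp
  then have "K * (2 * norm (z - y)) \<le> K * ?s" using s by (simp add: field_simps)
  then have "2 * norm (z - y) \<le> ?s" using K by simp
  then have "(2 * norm (z - y))\<^sup>2 \<le> ?s\<^sup>2" by (intro power_mono) auto
  then have "3 * (norm (z - y))\<^sup>2 \<le> \<delta>\<^sup>2" by (simp add: power_mult_distrib)
  then have "(norm (z - y))\<^sup>2 \<le> \<delta>\<^sup>2" using zero_le_power2[of "norm (z - y)"] by linarith
  then have zy: "norm (z - y) \<le> \<delta>" using \<delta>(1) by (auto intro: power2_le_imp_le)
  then have "dist (v z) (v y) < e / 2" using \<delta>(2) by (intro \<delta>0(2)) (simp add: dist_norm)
  then have vz: "v z \<le> v y + e / 2" unfolding dist_real_def by linarith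
  have "\<psi> x \<le> 2 * K * (\<delta> + norm (x - y))"
    unfolding \<psi>_def using K sqrt_sum_squares_le_sum[of \<delta> "norm (x - y)"] \<delta>(1)
    by (intro mult_left_mono) auto
  moreover have "0 \<le> \<psi> z" using K by (simp add: \<psi>_def)
  ultimately show "v x - v y \<le> 2 * K * norm (x - y) + e"
    using z[of x] vz K\<delta> by (simp add: distrib_left)
qed

text \<open>
  Coercivity bounds the gradient of a corrector. By periodicity only points in a common unit cube
  have to be compared, so the oscillation is bounded as well, uniformly for bounded \<open>p\<close>.
\<close>

lemma cell_solution_osc:
  fixes H :: "real^'n \<Rightarrow> real^'n \<Rightarrow> real"
  assumes cell: "cell_solution H p c v" and C: "0 < C"
    and coer: "\<And>x q. H x q \<ge> inverse C * norm q - C"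
    and K: "0 < K" "C * (c + C) + norm p \<le> K"
  shows "v x - v y \<le> 2 * K * real CARD('n)"
proof -
  have v: "continuous_on UNIV v" "integer_periodic v" using cell by (auto simp: cell_solution_def)
  have sub: "norm (grad \<psi> y) \<le> K" if "C1_on UNIV \<psi>" "\<And>z. v z - \<psi> z \<le> v y - \<psi> y" for \<psi> y
  proof -
    have "H y (p + grad \<psi> y) \<le> c" using cell that unfolding cell_solution_def by blast
    then have "inverse C * norm (p + grad \<psi> y) \<le> c + C" using coer[of "p + grad \<psi> y" y] by linarith
    then have "C * (inverse C * norm (p + grad \<psi> y)) \<le> C * (c + C)"
      by (rule mult_left_mono) (use C in simp)
    moreover have "C * (inverse C * norm (p + grad \<psi> y)) = norm (p + grad \<psi> y)"
      using C by (simp add: mult.assoc[symmetric])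
    ultimately have "norm (p + grad \<psi> y) \<le> C * (c + C)" by (simp only:)
    moreover have "norm (grad \<psi> y) \<le> norm (p + grad \<psi> y) + norm p"
      using norm_triangle_ineq4[of "p + grad \<psi> y" p] by simp
    ultimately show ?thesis using K(2) by linarith
  qed
  obtain k where k: "\<And>i. k $ i \<in> \<int>" "norm ((x - y) + k) \<le> real CARD('n)"
    by (rule integer_shift_into_box[of "x - y"]) blast
  have "v x - v y = v (x + k) - v y" using v(2) k(1) by (simp add: integer_periodic_def)
  also have "\<dots> \<le> 2 * K * norm ((x + k) - y)"
    by (rule periodic_subsolution_lipschitz[OF v K(1) sub])
  also have "(x + k) - y = (x - y) + k" by simp
  also have "2 * K * norm ((x - y) + k) \<le> 2 * K * real CARD('n)"
    using k(2) K(1) by (intro mult_left_mono) auto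
  finally show ?thesis .
qed

text \<open>
  Comparison for the cell problem: doubling of variables with penalty \<open>l * (norm (x - y))\<^sup>2\<close>. The
  maximum exists since simultaneous integer shifts of \<open>x\<close> and \<open>y\<close> leave the functional
  unchanged, so that \<open>x\<close> may be taken in the unit cube. Both correctors are tested with the same
  gradient \<open>g\<close>, which cancels because \<open>H\<close> is Lipschitz in \<open>p\<close>; only the distance of order
  \<open>r\<close> between \<open>x\<close> and \<open>y\<close> is left, where \<open>l = 1 / r\<^sup>2\<close>.
\<close>

lemma cell_constant_lipschitz:
  fixes H :: "real^'n \<Rightarrow> real^'n \<Rightarrow> real"
  assumes v: "cell_solution H p c v" and v': "cell_solution H q c' v'"
    and C: "0 \<le> C" and H: "\<And>x y p q. \<bar>H x p - H y q\<bar> \<le> C * (norm (x - y) + norm (p - q))"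
  shows "c' - c \<le> C * norm (p - q)"
proof -
  have vc: "continuous_on UNIV v" "integer_periodic v" using v by (auto simp: cell_solution_def)
  have vc': "continuous_on UNIV v'" "integer_periodic v'" using v' by (auto simp: cell_solution_def)
  obtain B' where B': "\<And>x. \<bar>v' x\<bar> \<le> B'" using periodic_bounded[OF vc'] by blast
  obtain B where B: "\<And>x. \<bar>v x\<bar> \<le> B" using periodic_bounded[OF vc] by blast
  show ?thesis
  proof (rule le_from_linear_error)
    fix r :: real assume r: "0 < r" "r < 1"
    define l where "l = 1 / r\<^sup>2"
    have l: "0 < l" using r by (simp add: l_def)
    define f where "f = (\<lambda>z::(real^'n) \<times> (real^'n). v (fst z) - v' (snd z) - l * (norm (fst z - snd z))\<^sup>2)"
    define S where "S = cbox 0 (1::real^'n) \<times> (UNIV :: (real^'n) set)"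
    have S: "closed S" unfolding S_def by (intro closed_Times closed_cbox closed_UNIV)
    have z0: "(0, 0) \<in> S" by (simp add: S_def mem_box_cart)
    have cont: "continuous_on S f"
    proof -
      have "continuous_on S (\<lambda>z. v (fst z))"
        by (rule continuous_on_compose2[OF vc(1) continuous_on_fst[OF continuous_on_id]]) simp
      moreover have "continuous_on S (\<lambda>z. v' (snd z))"
        by (rule continuous_on_compose2[OF vc'(1) continuous_on_snd[OF continuous_on_id]]) simp
      moreover have "continuous_on S (\<lambda>z. l * (norm (fst z - snd z))\<^sup>2)"
        by (intro continuous_on_mult_left continuous_on_power continuous_on_norm continuous_on_diff
            continuous_on_fst continuous_on_snd continuous_on_id)
      ultimately show ?thesis unfolding f_def by (intro continuous_on_diff)
    qed
    have bd: "bounded {z \<in> S. f (0, 0) \<le> f z}"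
    proof (rule bounded_subset)
      let ?R = "real CARD('n)" and ?R' = "sqrt ((2 * B + 2 * B') / l)"
      show "bounded (cbox 0 (1::real^'n) \<times> cball (0::real^'n) (?R + ?R'))"
        by (intro bounded_Times bounded_cbox bounded_cball)
      show "{z \<in> S. f (0, 0) \<le> f z} \<subseteq> cbox 0 (1::real^'n) \<times> cball (0::real^'n) (?R + ?R')"
      proof
        fix z assume "z \<in> {z \<in> S. f (0, 0) \<le> f z}"
        then obtain x y where z: "z = (x, y)" "x \<in> cbox 0 1" "f (0, 0) \<le> f (x, y)"
          by (cases z) (auto simp: S_def)
        have "l * (norm (x - y))\<^sup>2 \<le> 2 * B + 2 * B'"
          using z(3) B[of 0] B[of x] B'[of 0] B'[of y] unfolding f_def fst_conv snd_conv abs_le_iff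
          by (simp del: zero_le_mult_iff)
        then have xy: "norm (x - y) \<le> ?R'" using l by (auto intro!: real_le_rsqrt simp: le_divide_eq mult.commute)
        have "norm x \<le> (\<Sum>i\<in>UNIV. \<bar>x $ i\<bar>)" by (rule norm_le_l1_cart)
        also have "\<dots> \<le> (\<Sum>i\<in>(UNIV :: 'n set). 1)"
        proof (rule sum_mono)
          fix i
          have "0 \<le> x $ i" "x $ i \<le> 1" using z(2) by (simp_all add: mem_box_cart)
          then show "\<bar>x $ i\<bar> \<le> 1" by linarith
        qed
        finally have "norm y \<le> ?R + ?R'"
          using xy norm_triangle_ineq4[of x "x - y"] by simp
        then show "z \<in> cbox 0 (1::real^'n) \<times> cball (0::real^'n) (?R + ?R')" using z by simp
      qed
    qed
    obtain zm where zm: "zm \<in> S" "\<And>w. w \<in> S \<Longrightarrow> f w \<le> f zm"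
      by (rule attains_max_of_bounded_superlevel[OF S cont z0 bd]) (rule that)
    obtain x y where xy: "zm = (x, y)" by (cases zm)
    have max: "v x' - v' y' - l * (norm (x' - y'))\<^sup>2 \<le> v x - v' y - l * (norm (x - y))\<^sup>2" for x' y'
    proof -
      obtain k where k: "\<And>i. k $ i \<in> \<int>" "x' + k \<in> cbox 0 1" by (rule integer_shift_into_box[of x']) blast
      have "f (x' + k, y' + k) \<le> f zm" using k(2) by (intro zm(2)) (simp add: S_def)
      moreover have "v (x' + k) = v x'" "v' (y' + k) = v' y'"
        using vc(2) vc'(2) k(1) by (simp_all add: integer_periodic_def)
      ultimately show ?thesis by (simp add: f_def xy)
    qed
    have dist: "norm (x - y) \<le> r * sqrt (2 * B')"
    proof (rule power2_le_imp_le)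
      have "l * (norm (x - y))\<^sup>2 \<le> 2 * B'" using max[of x x] B'[of x] B'[of y] by (simp add: abs_le_iff)
      then have "(norm (x - y))\<^sup>2 \<le> r\<^sup>2 * (2 * B')" using r by (simp add: l_def divide_le_eq mult.commute)
      moreover have "0 \<le> B'" using B'[of 0] by linarith
      ultimately show "(norm (x - y))\<^sup>2 \<le> (r * sqrt (2 * B'))\<^sup>2" by (simp add: power_mult_distrib)
      show "0 \<le> r * sqrt (2 * B')" using r \<open>0 \<le> B'\<close> by simp
    qed
    define g where "g = (2 * l) *\<^sub>R (x - y)"
    have "H x (p + grad (\<lambda>x'. l * (norm (x' - y))\<^sup>2) x) \<le> c"
    proof -
      have "\<forall>x'. v x' - l * (norm (x' - y))\<^sup>2 \<le> v x - l * (norm (x - y))\<^sup>2" using max[of _ y] by simp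
      then show ?thesis using v C1_on_sqdist[of UNIV l y] unfolding cell_solution_def by blast
    qed
    then have 1: "H x (p + g) \<le> c" unfolding grad_eq[OF GDERIV_sqdist] g_def .
    have "c' \<le> H y (q + grad (\<lambda>y'. (- l) * (norm (y' - x))\<^sup>2) y)"
    proof -
      have "\<forall>y'. v' y' - (- l) * (norm (y' - x))\<^sup>2 \<ge> v' y - (- l) * (norm (y - x))\<^sup>2"
      proof
        fix y'
        show "v' y - (- l) * (norm (y - x))\<^sup>2 \<le> v' y' - (- l) * (norm (y' - x))\<^sup>2"
          using max[of x y'] by (simp add: norm_minus_commute[of x])
      qed
      then show ?thesis using v' C1_on_sqdist[of UNIV "- l" x] unfolding cell_solution_def by blast
    qed
    moreover have "(2 * - l) *\<^sub>R (y - x) = g" by (simp add: g_def algebra_simps)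
    ultimately have 2: "c' \<le> H y (q + g)" unfolding grad_eq[OF GDERIV_sqdist] by (simp only:)
    have "\<bar>H y (q + g) - H x (p + g)\<bar> \<le> C * (norm (y - x) + norm ((q + g) - (p + g)))" by (rule H)
    also have "\<dots> = C * (norm (x - y) + norm (p - q))" by (simp add: norm_minus_commute)
    also have "\<dots> \<le> C * (r * sqrt (2 * B') + norm (p - q))" using dist C by (intro mult_left_mono) auto
    finally have "c' - c \<le> C * (r * sqrt (2 * B') + norm (p - q))" using 1 2 by linarith
    then show "c' - c - r * (C * sqrt (2 * B')) \<le> C * norm (p - q)"
      by (simp add: distrib_left mult.left_commute)
  qed
qed

section \<open>Consequences of the doubling argument\<close>

text \<open>
  The doubling argument with \<open>w = 0\<close>, \<open>v = 0\<close>, \<open>\<eta> = e = 1\<close> and \<open>d = 2\<close>. The bound depends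
  on \<open>F\<close> only through \<open>C\<close> and \<open>c\<close>, so it is uniform in \<open>\<epsilon>\<close> for the Hamiltonians
  \<open>H (x / \<epsilon>) p\<close>.
\<close>

lemma subsolution_upper_bound:
  fixes u :: "'a::euclidean_space \<times> real \<Rightarrow> real"
  assumes T: "0 < T" and \<alpha>: "0 < \<alpha>" "\<alpha> < 1"
    and u: "caputo_subsolution \<alpha> T F u0 u" "BUC_on (space_time T) u"
    and F: "\<And>x y p q. \<bar>F x p - F y q\<bar> \<le> C' * norm (x - y) + C * norm (p - q)"
    and C: "0 \<le> C" and low: "\<And>x p. norm p \<le> 2 \<Longrightarrow> - c \<le> F x p"
    and init: "\<And>x. u (x, 0) \<le> A" and t: "t \<in> {0..T}"
  shows "u (x, t) \<le> A + 1 + T powr \<alpha> * Gamma (1 - \<alpha>) * max 0 (c + 16 * C)"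
proof -
  let ?w = "\<lambda>_ :: 'a \<times> real. 0 :: real"
  have w: "caputo_subsolution \<alpha> T (\<lambda>_ _. 0) (\<lambda>_. 0) ?w" by (rule zero_subsolution[OF \<alpha> T])
  have wB: "BUC_on (space_time T) ?w"
    by (auto simp: BUC_on_def uniformly_continuous_on_const bounded_iff)
  have half: "(0::real) \<le> 1/2" by simp
  obtain x0 y0 t0 where t0: "t0 \<in> {0..T}" and near: "\<And>x y t. t \<in> {0..T} \<Longrightarrow>
      u (x, t) + ?w (y, t) - (1/2) * (norm (x - y))\<^sup>2 \<le>
      u (x0, t0) + ?w (y0, t0) - (1/2) * (norm (x0 - y0))\<^sup>2 + 1"
    by (rule near_maximiser[OF u(2) wB T half zero_less_one]) (rule that)
  define M where "M = u (x0, t0) + ?w (y0, t0) - (1/2) * (norm (x0 - y0))\<^sup>2"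
  have p0: "norm (x0 - y0) \<le> 2"
  proof (rule power2_le_imp_le)
    show "(norm (x0 - y0))\<^sup>2 \<le> 2\<^sup>2" using near[OF t0, of x0 x0] by simp
  qed simp
  have "M \<le> A + 0 + 0 * (norm (x0 - y0) + 2 * 2) +
    T powr \<alpha> * Gamma (1 - \<alpha>) * max 0 (- 0 - (- c) + 8 * C * 2 / 1)"
  proof (rule perturbed_doubling[OF T \<alpha> u w wB F, where v = "\<lambda>_. 0" and \<eta> = 1 and e = 1 and ?p0.0 = "x0 - y0"])
    fix \<psi> :: "'a \<Rightarrow> real" and y assume "C1_on UNIV \<psi>" "\<And>z. (0::real) - \<psi> y \<le> 0 - \<psi> z"
    then have "grad \<psi> y = 0" by (intro C1_on_max_grad) auto
    then show "- c \<le> F y (x0 - y0 + grad \<psi> y)" using low[of "x0 - y0"] p0 by simp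
  next
    show "u (x, t) + ?w (y, t) - 1 / (2 * 1) * (norm (x - y))\<^sup>2 \<le> M + 1" if "t \<in> {0..T}" for x y t
      using near[OF that, of x y] by (simp add: M_def)
    show "t0 \<in> {0..T}" by (rule t0)
  qed (use C init in \<open>auto simp: M_def\<close>)
  moreover have "u (x, t) \<le> M + 1" using near[OF t, of x x] by (simp add: M_def)
  ultimately show ?thesis by (simp add: mult.commute[of C])
qed

text \<open>
  Comparison for Hamiltonians without \<open>x\<close>: the doubling argument with \<open>v = 0\<close>, which is a
  corrector for every \<open>p\<close>. The scaling \<open>\<eta> = h\<close>, \<open>e = h ^ 3\<close>, \<open>d = 2 * h\<^sup>2\<close> makes \<open>d / \<eta>\<close> of
  order \<open>h\<close>, so all errors vanish with \<open>h\<close>. Here \<open>h = r\<^sup>2\<close>, as \<open>norm (x0 - y0)\<close> is only known to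
  be of order \<open>sqrt h\<close>.
\<close>

lemma comparison_homogeneous:
  fixes u w :: "'a::euclidean_space \<times> real \<Rightarrow> real"
  assumes T: "0 < T" and \<alpha>: "0 < \<alpha>" "\<alpha> < 1"
    and u: "caputo_subsolution \<alpha> T (\<lambda>_. F) u0 u" "BUC_on (space_time T) u"
    and w: "caputo_subsolution \<alpha> T (\<lambda>_. G) w0 w" "BUC_on (space_time T) w"
    and F: "\<And>p q. \<bar>F p - F q\<bar> \<le> C * norm (p - q)" and G: "\<And>p q. \<bar>G p - G q\<bar> \<le> C * norm (p - q)"
    and FG: "\<And>p. 0 \<le> F p + G (- p)" and C: "0 \<le> C"
    and init: "\<And>x y. u (x, 0) + w (y, 0) \<le> A + L * norm (x - y)" and L: "0 \<le> L"
    and t: "t \<in> {0..T}"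
  shows "u (x, t) + w (x, t) \<le> A"
proof -
  obtain B1 where B1: "\<And>x t. t \<in> {0..T} \<Longrightarrow> \<bar>w (x, t)\<bar> \<le> B1" using BUC_bounded[OF w(2)] by blast
  define B where "B = max B1 0"
  have wB: "\<bar>w (x, t)\<bar> \<le> B" if "t \<in> {0..T}" for x t using B1[OF that, of x] by (auto simp: B_def)
  define S where "S = sqrt (2 * (2 * B + 1))"
  define TG where "TG = T powr \<alpha> * Gamma (1 - \<alpha>)"
  have TG: "0 \<le> TG" using \<alpha> Gamma_real_pos[of "1 - \<alpha>"] by (simp add: TG_def)
  show ?thesis
  proof (rule le_from_linear_error)
    fix r :: real assume r: "0 < r" "r < 1"
    define h where "h = r\<^sup>2"
    have h: "0 < h" "h \<le> r" using r mult_left_le[of r r] unfolding h_def power2_eq_square by auto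
    then have h1: "h \<le> 1" using r by linarith
    have h3: "0 < h ^ 3" using h by simp
    have hk: "0 \<le> 1 / (2 * h)" using h by simp
    obtain x0 y0 t0 where t0: "t0 \<in> {0..T}" and near: "\<And>x y t. t \<in> {0..T} \<Longrightarrow>
        u (x, t) + w (y, t) - 1 / (2 * h) * (norm (x - y))\<^sup>2 \<le>
        u (x0, t0) + w (y0, t0) - 1 / (2 * h) * (norm (x0 - y0))\<^sup>2 + h ^ 3"
      by (rule near_maximiser[OF u(2) w(2) T hk h3]) (rule that)
    define M where "M = u (x0, t0) + w (y0, t0) - 1 / (2 * h) * (norm (x0 - y0))\<^sup>2"
    have h31: "h ^ 3 \<le> h" "h ^ 2 \<le> h"
      using h h1 power_decreasing[of 1 3 h] power_decreasing[of 1 2 h] by auto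
    have dist: "norm (x0 - y0) \<le> r * S"
    proof (rule power2_le_imp_le)
      have "1 / (2 * h) * (norm (x0 - y0))\<^sup>2 \<le> 2 * B + 1"
        using near[OF t0, of x0 x0] wB[OF t0, of x0] wB[OF t0, of y0] h31 h1 by (simp add: abs_le_iff)
      then have "(norm (x0 - y0))\<^sup>2 \<le> h * (2 * (2 * B + 1))" using h by (simp add: field_simps)
      also have "\<dots> = (r * S)\<^sup>2" by (simp add: h_def S_def B_def power_mult_distrib)
      finally show "(norm (x0 - y0))\<^sup>2 \<le> (r * S)\<^sup>2" .
      show "0 \<le> r * S" using r by (simp add: S_def B_def)
    qed
    define p0 where "p0 = (1 / h) *\<^sub>R (x0 - y0)"
    have "M \<le> A + 0 + L * (norm (x0 - y0) + 2 * (2 * h\<^sup>2)) +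
      T powr \<alpha> * Gamma (1 - \<alpha>) * max 0 (- G (- p0) - F p0 + 8 * C * (2 * h\<^sup>2) / h)"
    proof (rule perturbed_doubling[OF T \<alpha> u w, where v = "\<lambda>_. 0" and \<eta> = h and e = "h^3" and C' = 0 and C = C])
      show "\<bar>F p - F q\<bar> \<le> 0 * norm (x - y) + C * norm (p - q)" for x y :: 'a and p q using F by simp
      fix \<psi> :: "'a \<Rightarrow> real" and y assume "C1_on UNIV \<psi>" "\<And>z. (0::real) - \<psi> y \<le> 0 - \<psi> z"
      then have "grad \<psi> y = 0" by (intro C1_on_max_grad) auto
      then show "F p0 \<le> F (p0 + grad \<psi> y)" by simp
    next
      show "u (x, t) + w (y, t) - 1 / (2 * h) * (norm (x - y))\<^sup>2 \<le> M + h ^ 3" if "t \<in> {0..T}" for x y t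
        using near[OF that, of x y] by (simp add: M_def)
      show "t0 \<in> {0..T}" by (rule t0)
      have "h * h ^ 3 < 4 * (h * h ^ 3)" using h by simp
      also have "\<dots> = (2 * h\<^sup>2)\<^sup>2" by (simp add: power2_eq_square power3_eq_cube)
      finally show "h * (h ^ 3 + 0) < (2 * h\<^sup>2)\<^sup>2" by simp
    qed (use h init L G in \<open>auto simp: M_def p0_def\<close>)
    also have "\<dots> \<le> A + L * (r * S + 4 * r) + TG * (16 * C * r)"
    proof -
      have "h\<^sup>2 \<le> r" using h31 h by linarith
      then have "L * (norm (x0 - y0) + 2 * (2 * h\<^sup>2)) \<le> L * (r * S + 4 * r)"
        using dist L by (intro mult_left_mono) auto
      moreover have "max 0 (- G (- p0) - F p0 + 8 * C * (2 * h\<^sup>2) / h) \<le> 16 * C * r"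
      proof -
        have "8 * C * (2 * h\<^sup>2) / h = 16 * C * h" using h by (simp add: power2_eq_square)
        also have "\<dots> \<le> 16 * C * r" using h C by (intro mult_left_mono) auto
        finally show ?thesis using FG[of p0] C r by simp
      qed
      then have "TG * max 0 (- G (- p0) - F p0 + 8 * C * (2 * h\<^sup>2) / h) \<le> TG * (16 * C * r)"
        using TG by (rule mult_left_mono)
      ultimately show ?thesis by (simp add: TG_def)
    qed
    finally have "M \<le> A + r * (L * (S + 4) + TG * (16 * C))" by (simp add: algebra_simps)
    moreover have "u (x, t) + w (x, t) \<le> M + h ^ 3" using near[OF t, of x x] by (simp add: M_def)
    ultimately show "u (x, t) + w (x, t) - r * (L * (S + 4) + TG * (16 * C) + 1) \<le> A"
      using h31 h by (simp add: algebra_simps)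
  qed
qed

text \<open>
  The homogenization estimate in one direction, with \<open>\<epsilon> = h ^ 3\<close>. The Lipschitz bound for \<open>w\<close>
  keeps the slope \<open>p0\<close> bounded, so the corrector \<open>\<epsilon> * v (x / \<epsilon>)\<close> oscillates by at most
  \<open>\<epsilon> * V\<close> and displaces the maximum by \<open>d\<close> of order \<open>sqrt (\<eta> * \<epsilon>)\<close>. The doubling
  argument therefore costs \<open>\<eta>\<close>, for the distance of \<open>x0\<close> and \<open>y0\<close>, plus
  \<open>d / \<eta> = sqrt (\<epsilon> / \<eta>)\<close>, up to constants. The choice \<open>\<eta> = h\<close> balances the two.
\<close>

lemma one_sided_rate:
  fixes u w :: "'a::euclidean_space \<times> real \<Rightarrow> real"
  assumes T: "0 < T" and \<alpha>: "0 < \<alpha>" "\<alpha> < 1" and h: "0 < h" "h \<le> 1"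
    and u: "caputo_subsolution \<alpha> T (\<lambda>x p. F (x /\<^sub>R h ^ 3) p) u0 u" "BUC_on (space_time T) u"
    and w: "caputo_subsolution \<alpha> T (\<lambda>_. G) w0 w" "BUC_on (space_time T) w"
    and F: "\<And>x y p q. \<bar>F x p - F y q\<bar> \<le> C * (norm (x - y) + norm (p - q))"
    and G: "\<And>p q. \<bar>G p - G q\<bar> \<le> C * norm (p - q)" and C: "0 \<le> C"
    and corrector: "\<And>p. norm p \<le> 2 * L + 2 \<Longrightarrow> \<exists>v. continuous_on UNIV v \<and> (\<forall>x y. v x - v y \<le> V) \<and>
      (\<forall>\<psi> y. C1_on UNIV \<psi> \<longrightarrow> (\<forall>z. v z - \<psi> z \<ge> v y - \<psi> y) \<longrightarrow> - G (- p) \<le> F y (p + grad \<psi> y))"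
    and init: "\<And>x y. u (x, 0) + w (y, 0) \<le> L * norm (x - y)"
    and L: "0 \<le> L" and lip: "\<And>x y t. t \<in> {0..T} \<Longrightarrow> w (x, t) - w (y, t) \<le> L * norm (x - y)"
    and V: "0 \<le> V" and t: "t \<in> {0..T}"
  shows "u (x, t) + w (x, t) \<le> (1 + V + L * (2 * L + 2 + 4 * (1 + V)) +
    T powr \<alpha> * Gamma (1 - \<alpha>) * (16 * C * (1 + V))) * h"
proof -
  let ?\<epsilon> = "h ^ 3"
  have \<epsilon>: "0 < ?\<epsilon>" "?\<epsilon> \<le> h" "h\<^sup>2 \<le> h"
    using h power_decreasing[of 1 3 h] power_decreasing[of 1 2 h] by auto
  have hk: "0 \<le> 1 / (2 * h)" using h by simp
  obtain x0 y0 t0 where t0: "t0 \<in> {0..T}" and near: "\<And>x y t. t \<in> {0..T} \<Longrightarrow>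
      u (x, t) + w (y, t) - 1 / (2 * h) * (norm (x - y))\<^sup>2 \<le>
      u (x0, t0) + w (y0, t0) - 1 / (2 * h) * (norm (x0 - y0))\<^sup>2 + ?\<epsilon>"
    by (rule near_maximiser[OF u(2) w(2) T hk \<epsilon>(1)]) (rule that)
  define M where "M = u (x0, t0) + w (y0, t0) - 1 / (2 * h) * (norm (x0 - y0))\<^sup>2"
  define p0 where "p0 = (1 / h) *\<^sub>R (x0 - y0)"
  define P where "P = norm p0"
  have xyP: "norm (x0 - y0) = h * P" using h by (simp add: P_def p0_def)
  have P: "P \<le> 2 * L + 2"
  proof (rule ccontr)
    assume "\<not> P \<le> 2 * L + 2"
    then have big: "2 * L + 2 < P" by simp
    have "1 / (2 * h) * (norm (x0 - y0))\<^sup>2 \<le> L * norm (y0 - x0) + ?\<epsilon>"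
      using near[OF t0, of x0 x0] lip[OF t0, of y0 x0] by simp
    moreover have "1 / (2 * h) * (norm (x0 - y0))\<^sup>2 = h * P\<^sup>2 / 2"
      using h unfolding xyP by (simp add: power_mult_distrib power2_eq_square)
    ultimately have "h * P\<^sup>2 / 2 \<le> L * (h * P) + h"
      using \<epsilon>(2) unfolding norm_minus_commute[of y0] xyP by linarith
    then have "h * P\<^sup>2 \<le> h * (2 * L * P + 2)" by (simp add: algebra_simps)
    then have "P * P \<le> 2 * L * P + 2" using h by (simp add: power2_eq_square)
    moreover have "(2 * L + 2) * P \<le> P * P" using big L by (intro mult_right_mono) auto
    ultimately have "P \<le> 1" by (simp add: algebra_simps)
    then show False using big L by simp
  qed
  then obtain v where v: "continuous_on UNIV v" "\<And>x y. v x - v y \<le> V"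
    and cell: "\<And>\<psi> y. C1_on UNIV \<psi> \<Longrightarrow> (\<And>z. v z - \<psi> z \<ge> v y - \<psi> y) \<Longrightarrow> - G (- p0) \<le> F y (p0 + grad \<psi> y)"
    using corrector[of p0] unfolding P_def by blast
  define d where "d = 2 * (1 + V) * h\<^sup>2"
  define TG where "TG = T powr \<alpha> * Gamma (1 - \<alpha>)"
  have "M \<le> 0 + ?\<epsilon> * V + L * (norm (x0 - y0) + 2 * d) +
    T powr \<alpha> * Gamma (1 - \<alpha>) * max 0 (- G (- p0) - (- G (- p0)) + 8 * C * d / h)"
  proof (rule perturbed_doubling[OF T \<alpha> u w, where v = "\<lambda>x. ?\<epsilon> * v (x /\<^sub>R ?\<epsilon>)" and \<eta> = h
        and e = ?\<epsilon> and C' = "C / ?\<epsilon>" and C = C])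
    show "\<bar>F (x /\<^sub>R ?\<epsilon>) p - F (y /\<^sub>R ?\<epsilon>) q\<bar> \<le> C / ?\<epsilon> * norm (x - y) + C * norm (p - q)" for x y p q
    proof -
      have "norm (x /\<^sub>R ?\<epsilon> - y /\<^sub>R ?\<epsilon>) = norm (x - y) / ?\<epsilon>"
        unfolding scaleR_diff_right[symmetric] using \<epsilon>(1) by (simp add: divide_inverse mult.commute)
      then show ?thesis using F[of "x /\<^sub>R ?\<epsilon>" p "y /\<^sub>R ?\<epsilon>" q] by (simp add: distrib_left)
    qed
    show "\<bar>G p - G q\<bar> \<le> C * norm (p - q)" for p q by (rule G)
    show "continuous_on UNIV (\<lambda>x. ?\<epsilon> * v (x /\<^sub>R ?\<epsilon>))"
      by (intro continuous_on_mult_left continuous_on_compose2[OF v(1)] continuous_on_scaleR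
          continuous_on_const continuous_on_id) auto
    show "?\<epsilon> * v (x /\<^sub>R ?\<epsilon>) - ?\<epsilon> * v (y /\<^sub>R ?\<epsilon>) \<le> ?\<epsilon> * V" for x y
      using mult_left_mono[OF v(2)[of "x /\<^sub>R ?\<epsilon>" "y /\<^sub>R ?\<epsilon>"], of ?\<epsilon>] \<epsilon> by (simp add: right_diff_distrib)
    fix \<psi> y assume \<psi>: "C1_on UNIV \<psi>"
      and min: "\<And>z. ?\<epsilon> * v (y /\<^sub>R ?\<epsilon>) - \<psi> y \<le> ?\<epsilon> * v (z /\<^sub>R ?\<epsilon>) - \<psi> z"
    define \<psi>' where "\<psi>' = (\<lambda>z. (1 / ?\<epsilon>) * \<psi> (?\<epsilon> *\<^sub>R z + 0))"
    have C1: "C1_on UNIV \<psi>'" unfolding \<psi>'_def by (intro C1_on_cmult C1_on_compose_affine(1) \<psi>)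
    obtain q where q: "GDERIV \<psi> y :> q" using C1_on_GDERIV[OF \<psi>] by blast
    have "GDERIV (\<lambda>z. \<psi> (?\<epsilon> *\<^sub>R z + 0)) (y /\<^sub>R ?\<epsilon>) :> ?\<epsilon> *\<^sub>R q"
      by (rule C1_on_compose_affine(2)[OF \<psi>]) (use q \<epsilon> in simp)
    from GDERIV_mult[OF GDERIV_const[of "1 / ?\<epsilon>"] this]
    have "GDERIV \<psi>' (y /\<^sub>R ?\<epsilon>) :> q" unfolding \<psi>'_def using \<epsilon> by simp
    then have gr: "grad \<psi>' (y /\<^sub>R ?\<epsilon>) = grad \<psi> y" using q by (simp add: grad_eq)
    have "- G (- p0) \<le> F (y /\<^sub>R ?\<epsilon>) (p0 + grad \<psi>' (y /\<^sub>R ?\<epsilon>))"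
    proof (rule cell[OF C1])
      fix z
      have "(?\<epsilon> * v (y /\<^sub>R ?\<epsilon>) - \<psi> y) / ?\<epsilon> \<le> (?\<epsilon> * v (?\<epsilon> *\<^sub>R z /\<^sub>R ?\<epsilon>) - \<psi> (?\<epsilon> *\<^sub>R z)) / ?\<epsilon>"
        using min[of "?\<epsilon> *\<^sub>R z"] \<epsilon> by (intro divide_right_mono) auto
      then show "v (y /\<^sub>R ?\<epsilon>) - \<psi>' (y /\<^sub>R ?\<epsilon>) \<le> v z - \<psi>' z"
        using \<epsilon> by (simp add: \<psi>'_def diff_divide_distrib)
    qed
    then show "- G (- p0) \<le> F (y /\<^sub>R ?\<epsilon>) (p0 + grad \<psi> y)" unfolding gr .
  next
    show "u (x, t) + w (y, t) - 1 / (2 * h) * (norm (x - y))\<^sup>2 \<le> M + ?\<epsilon>" if "t \<in> {0..T}" for x y t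
      using near[OF that, of x y] by (simp add: M_def)
    show "t0 \<in> {0..T}" by (rule t0)
    show "0 < d" using h V by (simp add: d_def)
    have "h * (?\<epsilon> + ?\<epsilon> * V) = (1 + V) * h ^ 4" by (simp add: algebra_simps power_numeral_reduce)
    also have "\<dots> < 4 * (1 + V)\<^sup>2 * h ^ 4"
    proof -
      have "1 + V \<le> (1 + V)\<^sup>2" using V by (simp add: power2_eq_square mult_left_mono algebra_simps)
      then have "1 + V < 4 * (1 + V)\<^sup>2" using V by linarith
      then show ?thesis using h by (intro mult_strict_right_mono) auto
    qed
    also have "\<dots> = d\<^sup>2" unfolding d_def power_mult_distrib by simp
    finally show "h * (?\<epsilon> + ?\<epsilon> * V) < d\<^sup>2" .
    show "u (x, 0) + w (y, 0) \<le> 0 + L * norm (x - y)" for x y using init by simp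
  qed (use h L in \<open>auto simp: M_def p0_def\<close>)
  also have "\<dots> \<le> h * V + L * (h * (2 * L + 2 + 4 * (1 + V))) + TG * (16 * C * (1 + V) * h)"
  proof (intro add_mono)
    show "0 + ?\<epsilon> * V \<le> h * V" using \<epsilon> V by (simp add: mult_right_mono)
    have "h * P \<le> h * (2 * L + 2)" using P h by (intro mult_left_mono) auto
    moreover have "4 * (1 + V) * h\<^sup>2 \<le> 4 * (1 + V) * h" using \<epsilon>(3) V by (intro mult_left_mono) auto
    then have "2 * d \<le> 4 * (1 + V) * h" unfolding d_def by linarith
    ultimately have "norm (x0 - y0) + 2 * d \<le> h * (2 * L + 2 + 4 * (1 + V))"
      unfolding xyP by (simp add: algebra_simps)
    then show "L * (norm (x0 - y0) + 2 * d) \<le> L * (h * (2 * L + 2 + 4 * (1 + V)))"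
      using L by (rule mult_left_mono)
    have "8 * C * d / h = 16 * C * (1 + V) * h" using h by (simp add: d_def power2_eq_square)
    moreover have "0 \<le> 16 * C * (1 + V) * h" using h V C by simp
    ultimately show "T powr \<alpha> * Gamma (1 - \<alpha>) * max 0 (- G (- p0) - (- G (- p0)) + 8 * C * d / h)
      \<le> TG * (16 * C * (1 + V) * h)" by (simp add: TG_def)
  qed
  finally have "M \<le> h * V + L * (h * (2 * L + 2 + 4 * (1 + V))) + TG * (16 * C * (1 + V) * h)" .
  moreover have "u (x, t) + w (x, t) \<le> M + ?\<epsilon>" using near[OF t, of x x] by (simp add: M_def)
  ultimately have "u (x, t) + w (x, t) \<le> h + h * V + L * (h * (2 * L + 2 + 4 * (1 + V))) + TG * (16 * C * (1 + V) * h)"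
    using \<epsilon>(2) by linarith
  also have "\<dots> = (1 + V + L * (2 * L + 2 + 4 * (1 + V)) + TG * (16 * C * (1 + V))) * h"
    by (simp add: algebra_simps)
  finally show ?thesis by (simp only: TG_def)
qed

section \<open>The rate of homogenization\<close>

lemma solution_initial:
  assumes "caputo_viscosity_solution \<alpha> T F u0 u"
  shows "u (x, 0) = u0 x"
  using assms unfolding caputo_viscosity_solution_def caputo_subsolution_def caputo_supersolution_def
  by (intro antisym) blast+

theorem theorem1p2:
  fixes T \<alpha> \<nu> :: real
    and H :: "real^'n \<Rightarrow> real^'n \<Rightarrow> real"
    and Hbar u0 :: "real^'n \<Rightarrow> real"
    and u :: "real \<Rightarrow> (real^'n) \<times> real \<Rightarrow> real"
    and ubar :: "(real^'n) \<times> real \<Rightarrow> real"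
  assumes "T > 0" and "0 < \<alpha>" and "\<alpha> < 1"
    and H_cont: "continuous_on UNIV (\<lambda>(y, p). H y p)"
    and u0_cont: "continuous_on UNIV u0"
    and A1: "((\<lambda>r. INF (y, p)\<in>{(y, p). norm p \<ge> r}. ereal (H y p)) \<longlongrightarrow> \<infinity>) at_top"
    and A2: "\<And>y k p. (\<forall>i. k $ i \<in> \<int>) \<Longrightarrow> H (y + k) p = H y p"
    and A3: "\<exists>L. L-lipschitz_on UNIV u0" "BUC_on UNIV u0"
    and A4: "\<exists>C>0. \<forall>x y p q. \<bar>H x p - H y q\<bar> \<le> C * (norm (x - y) + norm (p - q))"
    and A5: "\<exists>C>0. \<forall>x p. H x p \<ge> inverse C * norm p - C"
    and Hbar: "effective_hamiltonian H Hbar"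
    and u_BUC: "\<And>\<epsilon>. \<epsilon> > 0 \<Longrightarrow> BUC_on (space_time T) (u \<epsilon>)"
    and u_sol: "\<And>\<epsilon>. \<epsilon> > 0 \<Longrightarrow>
      caputo_viscosity_solution \<alpha> T (\<lambda>x p. H (x /\<^sub>R \<epsilon>) p) u0 (u \<epsilon>)"
    and ubar_BUC: "BUC_on (space_time T) ubar"
    and ubar_sol: "caputo_viscosity_solution \<alpha> T (\<lambda>x p. Hbar p) u0 ubar"
    and "0 < \<nu>" and "\<nu> < 1"
  shows "\<exists>C>0. \<forall>\<epsilon>>0.
    (SUP z\<in>UNIV \<times> {0<..<T}. \<bar>u \<epsilon> z - ubar z\<bar>) \<le> C * \<epsilon> powr (1 / (3 * (2 - \<nu>)))"
proof -
  note T = \<open>0 < T\<close>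
  note \<alpha> = \<open>0 < \<alpha>\<close> \<open>\<alpha> < 1\<close>
  obtain C where C: "0 < C" and HL: "\<And>x y p q. \<bar>H x p - H y q\<bar> \<le> C * (norm (x - y) + norm (p - q))"
    using A4 by blast
  obtain K5 where K5: "0 < K5" and coer: "\<And>x p. H x p \<ge> inverse K5 * norm p - K5"
    using A5 by blast
  obtain L where lip: "L-lipschitz_on UNIV u0" using A3(1) by blast
  have L: "0 \<le> L" using lip by (rule lipschitz_on_nonneg)
  have u0L: "u0 x - u0 y \<le> L * norm (x - y)" for x y
    using lipschitz_onD[OF lip, of x y] by (simp add: dist_norm abs_le_iff)
  obtain U0 where U0: "\<And>x. \<bar>u0 x\<bar> \<le> U0" using A3(2) unfolding BUC_on_def bounded_iff by auto
  define TG where "TG = T powr \<alpha> * Gamma (1 - \<alpha>)"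
  have TG: "0 \<le> TG" using \<alpha> Gamma_real_pos[of "1 - \<alpha>"] by (simp add: TG_def)

  have cell: "\<exists>v. cell_solution H p (Hbar p) v" for p
    using Hbar unfolding effective_hamiltonian_def by blast
  have HbarL1: "Hbar q - Hbar p \<le> C * norm (p - q)" for p q
    using cell[of p] cell[of q] cell_constant_lipschitz[OF _ _ _ HL] C by (metis less_imp_le)
  have HbarL: "\<bar>Hbar p - Hbar q\<bar> \<le> C * norm (p - q)" for p q
    using HbarL1[of p q] HbarL1[of q p] by (simp add: abs_le_iff norm_minus_commute)
  \<comment> \<open>The Hamiltonian of the reflected function \<open>- ubar\<close>.\<close>
  define Gm where "Gm = (\<lambda>p. - Hbar (- p))"
  have GmL: "\<bar>Gm p - Gm q\<bar> \<le> C * norm (p - q)" for p q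
    using HbarL[of "- p" "- q"] by (simp add: Gm_def norm_minus_commute)
  have HmL: "\<bar>- H x (- p) - - H y (- q)\<bar> \<le> C * (norm (x - y) + norm (p - q))" for x y p q
    using HL[of x "- p" y "- q"] by (simp add: norm_minus_commute abs_minus_commute)

  have ubar_sub: "caputo_subsolution \<alpha> T (\<lambda>_. Hbar) u0 ubar"
    and ubar_super: "caputo_supersolution \<alpha> T (\<lambda>_. Hbar) u0 ubar"
    using ubar_sol by (auto simp: caputo_viscosity_solution_def)
  have ubar_neg: "caputo_subsolution \<alpha> T (\<lambda>_. Gm) (\<lambda>x. - u0 x) (\<lambda>z. - ubar z)"
    using supersolution_uminus[OF ubar_super] by (simp add: Gm_def)
  have ubar_neg_BUC: "BUC_on (space_time T) (\<lambda>z. - ubar z)" by (rule BUC_on_uminus[OF ubar_BUC])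
  have ubar0: "ubar (x, 0) = u0 x" for x by (rule solution_initial[OF ubar_sol])
  have u_0: "u \<epsilon> (x, 0) = u0 x" if "0 < \<epsilon>" for \<epsilon> x by (rule solution_initial[OF u_sol[OF that]])

  \<comment> \<open>Translates of \<open>ubar\<close> solve the same equation, and their initial values differ by at most
    \<open>L * norm (x - y)\<close>.\<close>
  have ubar_lip: "ubar (x, t) - ubar (y, t) \<le> L * norm (x - y)" if t: "t \<in> {0..T}" for x y t
  proof -
    define h where "h = x - y"
    have "ubar (fst (y, t) + h, snd (y, t)) + - ubar (y, t) \<le> L * norm h"
    proof (rule comparison_homogeneous[OF T \<alpha> subsolution_translate[OF ubar_sub ubar_BUC]
          BUC_translate[OF ubar_BUC] ubar_neg ubar_neg_BUC HbarL GmL _ _ _ L t])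
      show "0 \<le> Hbar p + Gm (- p)" for p by (simp add: Gm_def)
      show "0 \<le> C" using C by simp
      fix x y
      have "u0 (x + h) - u0 y \<le> L * norm (x + h - y)" by (rule u0L)
      also have "\<dots> \<le> L * (norm h + norm (x - y))"
        using norm_triangle_ineq[of h "x - y"] L by (intro mult_left_mono) (auto simp: algebra_simps)
      finally show "ubar (fst (x, 0::real) + h, snd (x, 0::real)) + - ubar (y, 0) \<le> L * norm h + L * norm (x - y)"
        by (simp add: ubar0 distrib_left)
    qed
    then show ?thesis by (simp add: h_def)
  qed

  \<comment> \<open>\<open>P\<close> is the bound on the frozen slopes and \<open>V\<close> the resulting bound on the oscillation of the
    correctors.\<close>
  define P where "P = 2 * L + 2"
  define K where "K = max 1 (K5 * (Hbar 0 + C * P + K5) + P)"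
  define V where "V = 2 * K * real CARD('n)"
  have V: "0 \<le> V" by (simp add: V_def K_def)
  have osc: "v x - v y \<le> V" if p: "norm p \<le> P" and v: "cell_solution H p (Hbar p) v" for p v x y
    unfolding V_def
  proof (rule cell_solution_osc[OF v K5 coer])
    show "0 < K" by (simp add: K_def)
    have "C * norm p \<le> C * P" using p C by (intro mult_left_mono) auto
    then have "Hbar p \<le> Hbar 0 + C * P" using HbarL1[of p 0] by simp
    then have "K5 * (Hbar p + K5) \<le> K5 * (Hbar 0 + C * P + K5)" using K5 by (intro mult_left_mono) auto
    then show "K5 * (Hbar p + K5) + norm p \<le> K" using p by (simp add: K_def)
  qed
  define R where "R = 1 + V + L * (2 * L + 2 + 4 * (1 + V)) + TG * (16 * C * (1 + V))"
  have R: "0 \<le> R" using V L TG C by (simp add: R_def)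

  have rate: "\<bar>u (h ^ 3) (x, t) - ubar (x, t)\<bar> \<le> R * h" if h: "0 < h" "h \<le> 1" and t: "t \<in> {0..T}" for h x t
  proof -
    have \<epsilon>: "0 < h ^ 3" using h by simp
    have sub: "caputo_subsolution \<alpha> T (\<lambda>x p. H (x /\<^sub>R h ^ 3) p) u0 (u (h ^ 3))"
      and super: "caputo_supersolution \<alpha> T (\<lambda>x p. H (x /\<^sub>R h ^ 3) p) u0 (u (h ^ 3))"
      using u_sol[OF \<epsilon>] by (auto simp: caputo_viscosity_solution_def)
    have neg: "caputo_subsolution \<alpha> T (\<lambda>x p. - H (x /\<^sub>R h ^ 3) (- p)) (\<lambda>x. - u0 x) (\<lambda>z. - u (h ^ 3) z)"
      by (rule supersolution_uminus[OF super])
    have "u (h ^ 3) (x, t) + - ubar (x, t) \<le> R * h"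
      unfolding R_def TG_def
    proof (rule one_sided_rate[where F = H and L = L and V = V, OF T \<alpha> h sub u_BUC[OF \<epsilon>] ubar_neg ubar_neg_BUC HL GmL])
      fix p :: "real^'n" assume p: "norm p \<le> 2 * L + 2"
      obtain v where v: "cell_solution H p (Hbar p) v" using cell by blast
      have "continuous_on UNIV v" "\<forall>\<psi> y. C1_on UNIV \<psi> \<longrightarrow> (\<forall>z. v z - \<psi> z \<ge> v y - \<psi> y) \<longrightarrow>
          H y (p + grad \<psi> y) \<ge> Hbar p"
        using v unfolding cell_solution_def by blast+
      moreover have "\<forall>x y. v x - v y \<le> V" using osc[OF _ v] p by (simp add: P_def)
      ultimately show "\<exists>v. continuous_on UNIV v \<and> (\<forall>x y. v x - v y \<le> V) \<and>
         (\<forall>\<psi> y. C1_on UNIV \<psi> \<longrightarrow> (\<forall>z. v z - \<psi> z \<ge> v y - \<psi> y) \<longrightarrow> - Gm (- p) \<le> H y (p + grad \<psi> y))"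
        unfolding Gm_def minus_minus by blast
    next
      show "u (h ^ 3) (x, 0) + - ubar (y, 0) \<le> L * norm (x - y)" for x y
        using u0L[of x y] by (simp add: ubar0 u_0[OF \<epsilon>])
      show "- ubar (x, t) - - ubar (y, t) \<le> L * norm (x - y)" if "t \<in> {0..T}" for x y t
        using ubar_lip[OF that, of y x] by (simp add: norm_minus_commute)
    qed (use C L V t in auto)
    moreover have "- u (h ^ 3) (x, t) + ubar (x, t) \<le> R * h"
      unfolding R_def TG_def
    proof (rule one_sided_rate[where F = "\<lambda>y p. - H y (- p)" and L = L and V = V,
          OF T \<alpha> h neg BUC_on_uminus[OF u_BUC[OF \<epsilon>]] ubar_sub ubar_BUC HmL HbarL])
      fix p :: "real^'n" assume p: "norm p \<le> 2 * L + 2"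
      obtain v where v: "cell_solution H (- p) (Hbar (- p)) v" using cell by blast
      have sub: "H y (- p + grad \<psi> y) \<le> Hbar (- p)"
        if "C1_on UNIV \<psi>" "\<forall>z. v z - \<psi> z \<le> v y - \<psi> y" for \<psi> y
        using v that unfolding cell_solution_def by blast
      have "- Hbar (- p) \<le> - H y (- (p + grad \<psi> y))"
        if \<psi>: "C1_on UNIV \<psi>" and min: "\<forall>z. - v z - \<psi> z \<ge> - v y - \<psi> y" for \<psi> y
      proof -
        obtain q where q: "GDERIV \<psi> y :> q" using C1_on_GDERIV[OF \<psi>] by blast
        have "\<forall>z. v z - - \<psi> z \<le> v y - - \<psi> y"
        proof
          fix z show "v z - - \<psi> z \<le> v y - - \<psi> y" using min[rule_format, of z] by linarith
        qed
        then have "H y (- p + grad (\<lambda>z. - \<psi> z) y) \<le> Hbar (- p)" by (rule sub[OF C1_on_minus[OF \<psi>]])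
        then show ?thesis unfolding grad_eq[OF q] grad_eq[OF GDERIV_minus[OF q]] by simp
      qed
      moreover have "continuous_on UNIV (\<lambda>x. - v x)"
        using v unfolding cell_solution_def by (intro continuous_on_minus) blast
      moreover have "\<forall>x y. - v x - - v y \<le> V" using osc[OF _ v] p by (simp add: P_def)
      ultimately show "\<exists>v. continuous_on UNIV v \<and> (\<forall>x y. v x - v y \<le> V) \<and>
         (\<forall>\<psi> y. C1_on UNIV \<psi> \<longrightarrow> (\<forall>z. v z - \<psi> z \<ge> v y - \<psi> y) \<longrightarrow> - Hbar (- p) \<le> - H y (- (p + grad \<psi> y)))"
        by (intro exI[of _ "\<lambda>x. - v x"] conjI allI impI) auto
    next
      show "- u (h ^ 3) (x, 0) + ubar (y, 0) \<le> L * norm (x - y)" for x y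
        using u0L[of y x] by (simp add: ubar0 u_0[OF \<epsilon>] norm_minus_commute)
      show "ubar (x, t) - ubar (y, t) \<le> L * norm (x - y)" if "t \<in> {0..T}" for x y t
        using ubar_lip[OF that] .
    qed (use C L V t in auto)
    ultimately show ?thesis by (simp add: abs_le_iff)
  qed

  \<comment> \<open>Periodicity makes \<open>H\<close> bounded for bounded slopes, which gives the bound on \<open>u \<epsilon>\<close> that is
    used for \<open>\<epsilon> > 1\<close>.\<close>
  define c2 where "c2 = H 0 0 + C * (real CARD('n) + 2)"
  have Hup: "H y p \<le> c2" if p: "norm p \<le> 2" for y p
  proof -
    obtain k where k: "\<And>i. k $ i \<in> \<int>" "norm (y + k) \<le> real CARD('n)"
      by (rule integer_shift_into_box[of y]) (rule that)
    have "H y p = H (y + k) p" using A2 k(1) by simp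
    also have "\<dots> \<le> H 0 0 + C * (norm (y + k) + norm p)" using HL[of "y + k" p 0 0] by (simp add: abs_le_iff)
    also have "\<dots> \<le> c2" unfolding c2_def using k(2) p C by (intro add_left_mono mult_left_mono) auto
    finally show ?thesis .
  qed
  define B1 where "B1 = U0 + 1 + TG * max 0 (K5 + 16 * C)"
  define B2 where "B2 = U0 + 1 + TG * max 0 (c2 + 16 * C)"
  obtain B3 where B3: "\<And>x t. t \<in> {0..T} \<Longrightarrow> \<bar>ubar (x, t)\<bar> \<le> B3" using BUC_bounded[OF ubar_BUC] by blast
  have crude: "\<bar>u \<epsilon> (x, t) - ubar (x, t)\<bar> \<le> max B1 B2 + B3" if \<epsilon>: "0 < \<epsilon>" and t: "t \<in> {0..T}" for \<epsilon> x t
  proof -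
    have sub: "caputo_subsolution \<alpha> T (\<lambda>x p. H (x /\<^sub>R \<epsilon>) p) u0 (u \<epsilon>)"
      and super: "caputo_supersolution \<alpha> T (\<lambda>x p. H (x /\<^sub>R \<epsilon>) p) u0 (u \<epsilon>)"
      using u_sol[OF \<epsilon>] by (auto simp: caputo_viscosity_solution_def)
    have HL\<epsilon>: "\<bar>H (x /\<^sub>R \<epsilon>) p - H (y /\<^sub>R \<epsilon>) q\<bar> \<le> C / \<epsilon> * norm (x - y) + C * norm (p - q)" for x y p q
    proof -
      have "norm (x /\<^sub>R \<epsilon> - y /\<^sub>R \<epsilon>) = norm (x - y) / \<epsilon>"
        unfolding scaleR_diff_right[symmetric] using \<epsilon> by (simp add: divide_inverse mult.commute)
      then show ?thesis using HL[of "x /\<^sub>R \<epsilon>" p "y /\<^sub>R \<epsilon>" q] by (simp add: distrib_left)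
    qed
    have "u \<epsilon> (x, t) \<le> B1" unfolding B1_def TG_def
    proof (rule subsolution_upper_bound[OF T \<alpha> sub u_BUC[OF \<epsilon>] HL\<epsilon> _ _ _ t])
      show "- K5 \<le> H (x /\<^sub>R \<epsilon>) p" for x p
      proof -
        have "0 \<le> inverse K5 * norm p" using K5 by simp
        then show ?thesis using coer[of p "x /\<^sub>R \<epsilon>"] by linarith
      qed
      show "u \<epsilon> (x, 0) \<le> U0" for x using U0[of x] by (simp add: u_0[OF \<epsilon>])
    qed (use C in simp)
    moreover have "- u \<epsilon> (x, t) \<le> B2" unfolding B2_def TG_def
    proof (rule subsolution_upper_bound[OF T \<alpha> supersolution_uminus[OF super] BUC_on_uminus[OF u_BUC[OF \<epsilon>]] _ _ _ _ t])
      show "\<bar>- H (x /\<^sub>R \<epsilon>) (- p) - - H (y /\<^sub>R \<epsilon>) (- q)\<bar> \<le> C / \<epsilon> * norm (x - y) + C * norm (p - q)" for x y p q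
        using HL\<epsilon>[of x "- p" y "- q"] by (simp add: norm_minus_commute abs_minus_commute)
      show "- c2 \<le> - H (x /\<^sub>R \<epsilon>) (- p)" if "norm p \<le> 2" for x p using Hup[of "- p"] that by simp
      show "- u \<epsilon> (x, 0) \<le> U0" for x using U0[of x] by (simp add: u_0[OF \<epsilon>])
    qed (use C in simp)
    ultimately show ?thesis using B3[OF t, of x] by linarith
  qed

  define s where "s = 1 / (3 * (2 - \<nu>))"
  have s: "0 < s" "s \<le> 1 / 3" using \<open>0 < \<nu>\<close> \<open>\<nu> < 1\<close> by (auto simp: s_def field_simps)
  define B where "B = max B1 B2 + B3"
  have B: "0 \<le> B" using crude[of 1 0 0] T unfolding B_def by force
  have point: "\<bar>u \<epsilon> z - ubar z\<bar> \<le> (R + B + 1) * \<epsilon> powr s"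
    if \<epsilon>: "0 < \<epsilon>" and z: "z \<in> UNIV \<times> {0<..<T}" for \<epsilon> z
  proof -
    obtain x t where zeq: "z = (x, t)" and t: "t \<in> {0..T}" using z by (cases z) auto
    show ?thesis
    proof (cases "\<epsilon> \<le> 1")
      case True
      define h where "h = \<epsilon> powr (1 / 3)"
      have h: "0 < h" "h \<le> 1" using \<epsilon> True by (auto simp: h_def powr_le1)
      have h3: "h ^ 3 = \<epsilon>" using \<epsilon> by (simp add: h_def powr_power)
      have "h \<le> \<epsilon> powr s" unfolding h_def using s(2) \<epsilon> True by (intro powr_mono') auto
      have "\<bar>u \<epsilon> z - ubar z\<bar> \<le> R * h" using rate[OF h t, of x] by (simp add: h3 zeq)
      also have "\<dots> \<le> R * \<epsilon> powr s" using \<open>h \<le> \<epsilon> powr s\<close> R by (rule mult_left_mono)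
      also have "\<dots> \<le> (R + B + 1) * \<epsilon> powr s" using B by (intro mult_right_mono) auto
      finally show ?thesis .
    next
      case False
      then have "1 \<le> \<epsilon> powr s" using s by (intro ge_one_powr_ge_zero) auto
      then have "B * 1 \<le> B * \<epsilon> powr s" using B by (rule mult_left_mono)
      also have "\<dots> \<le> (R + B + 1) * \<epsilon> powr s" using R by (intro mult_right_mono) auto
      finally show ?thesis using crude[OF \<epsilon> t, of x] by (simp add: zeq B_def)
    qed
  qed
  have ne: "(UNIV :: (real^'n) set) \<times> {0<..<T} \<noteq> {}" using T by auto
  show ?thesis
  proof (intro exI[of _ "R + B + 1"] conjI allI impI)
    show "0 < R + B + 1" using R B by simp
    show "(SUP z\<in>UNIV \<times> {0<..<T}. \<bar>u \<epsilon> z - ubar z\<bar>) \<le> (R + B + 1) * \<epsilon> powr (1 / (3 * (2 - \<nu>)))"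
      if "0 < \<epsilon>" for \<epsilon>
      using point[OF that] unfolding s_def by (intro cSUP_least[OF ne])
  qed
qed

end
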